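(* Let $d\in\{1,2,3\}$, $L>0$, let $\rho$ be a smooth density compactly supported in $\mathbf{R}_L=[-L,L]^d$, and let $S>1$ be the zero-padding factor. The finite Fourier series approximation of $\rho$ on $\mathbf{R}_{SL}$, implemented after the $S$-fold zero-padding of $\rho$, together with its periodic extension, guarantees a spectral approximation of $\rho$ within $\mathbf{R}_{(2S-1)L}$. Evaluating the potential $\Phi=U\ast\rho$ on $\mathbf{R}_L$ by the kernel truncation method requires an approximation of $\rho$ on $\mathbf{R}_{(2\sqrt d+1)L}$. Once the condition $$2\sqrt d+1\le 2S-1,\qquad\text{i.e.}\qquad \sqrt d+1\le S,$$ is satisfied, the $S$-fold zero-padding is both sufficient and necessary; therefore the optimal zero-padding factor is $$S=\sqrt d+1.$$ In practice it is convenient to choose $S=\lceil\sqrt d+1\rceil$, that is, $S=2$ for $d=1$ and $S=3$ for $d=2,3$.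
   Context: For $a>0$, $\mathbf{R}_a:=[-a,a]^d$. The nonlocal potential is $\Phi(\mathbf{x})=\int_{\mathbb{R}^d}U(\mathbf{x}-\mathbf{y})\rho(\mathbf{y})\,d\mathbf{y}$, where the kernel $U$ may be singular at the origin and/or at the far field. Since $\rho$ is supported in $\mathbf{R}_L$, one has $\Phi(\mathbf{x})=\int_{\mathbf{B}_G}U(\mathbf{y})\rho(\mathbf{x}-\mathbf{y})\,d\mathbf{y}$ for $\mathbf{x}\in\mathbf{R}_L$, where $\mathbf{B}_G$ is the ball centered at the origin with radius $G=2\sqrt d\,L$, the diameter of $\mathbf{R}_L$; for $\mathbf{x}\in\mathbf{R}_L$ and $\mathbf{y}\in\mathbf{B}_G$ one has $\mathbf{x}-\mathbf{y}\in\mathbf{R}_{(2\sqrt d+1)L}$. The kernel truncation method replaces $\rho$ in this integral by a finite Fourier series. The $S$-fold zero-padding of $\rho$ is its extension to $\mathbf{R}_{SL}$ by setting $\rho=0$ on $\mathbf{R}_{SL}\setminus\mathbf{R}_L$; the finite Fourier series on $\mathbf{R}_{SL}$ is $2SL$-periodic in each coordinate direction and is thereby extended to all of $\mathbb{R}^d$. "Spectral approximation" means approximation with spectral accuracy in the number of grid points per direction. $\lceil\cdot\rceil$ denotes rounding up to the nearest integer. *)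

theory Defs
  imports "HOL-Analysis.Analysis"
begin

definition cube :: "real \<Rightarrow> (real ^ 'n) set" where
  "cube a = cbox (\<chi> i. - a) (\<chi> i. a)"

text \<open>The ball of radius \<open>G = 2 * sqrt d * L\<close>, the diameter of \<open>cube L\<close>.\<close>

definition trunc_ball :: "real \<Rightarrow> (real ^ 'n) set" where
  "trunc_ball L = cball 0 (2 * sqrt (real CARD('n)) * L)"

text \<open>\<open>cont_diff k f\<close>: \<open>f\<close> is \<open>k\<close> times continuously differentiable on the whole space
  (all iterated directional derivatives of order at most \<open>k\<close> exist and are continuous).\<close>

primrec cont_diff :: "nat \<Rightarrow> (real ^ 'n \<Rightarrow> real) \<Rightarrow> bool" where
  "cont_diff 0 f \<longleftrightarrow> continuous_on UNIV f"
| "cont_diff (Suc k) f \<longleftrightarrow>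
     (\<forall>x. f differentiable (at x)) \<and> (\<forall>v. cont_diff k (\<lambda>x. frechet_derivative f (at x) v))"

definition smooth :: "(real ^ 'n \<Rightarrow> real) \<Rightarrow> bool" where
  "smooth f \<longleftrightarrow> (\<forall>k. cont_diff k f)"

definition densities :: "real \<Rightarrow> (real ^ 'n \<Rightarrow> real) set" where
  "densities L = {\<rho>. smooth \<rho> \<and> closure {x. \<rho> x \<noteq> 0} \<subseteq> cube L}"

text \<open>The zero-padding extends the restriction of \<open>\<rho>\<close> to \<open>cube L\<close> by zero. The padding factor
  \<open>S\<close> enters through the larger cube \<open>cube (S * L)\<close> on which the padded function is sampled
  and which fixes the period of the Fourier series.\<close>

definition zero_pad :: "real \<Rightarrow> (real ^ 'n \<Rightarrow> real) \<Rightarrow> real ^ 'n \<Rightarrow> real" where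
  "zero_pad L \<rho> = (\<lambda>x. if x \<in> cube L then \<rho> x else 0)"

text \<open>Finite Fourier series on \<open>cube a\<close> with \<open>N\<close> equispaced grid points per direction; the
  coefficients are given by the discrete Fourier transform of the grid values.\<close>

definition grid_indices :: "nat \<Rightarrow> (nat ^ 'n) set" where
  "grid_indices N = {j. \<forall>i. j $ i < N}"

definition grid_point :: "nat \<Rightarrow> real \<Rightarrow> nat ^ 'n \<Rightarrow> real ^ 'n" where
  "grid_point N a j = (\<chi> i. - a + 2 * a * real (j $ i) / real N)"

text \<open>For even \<open>N\<close> these are the frequencies \<open>-N/2, \<dots>, N/2 - 1\<close> in each direction.\<close>

definition frequencies :: "nat \<Rightarrow> (int ^ 'n) set" where
  "frequencies N = {k. \<forall>i. - int N \<le> 2 * k $ i \<and> 2 * k $ i < int N}"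

definition fourier_mode :: "real \<Rightarrow> int ^ 'n \<Rightarrow> real ^ 'n \<Rightarrow> complex" where
  "fourier_mode a k x = cis (pi / a * (\<Sum>i\<in>UNIV. of_int (k $ i) * x $ i))"

definition fourier_coeff :: "nat \<Rightarrow> real \<Rightarrow> (real ^ 'n \<Rightarrow> real) \<Rightarrow> int ^ 'n \<Rightarrow> complex" where
  "fourier_coeff N a f k =
     (\<Sum>j\<in>grid_indices N. of_real (f (grid_point N a j)) * cnj (fourier_mode a k (grid_point N a j)))
       / of_nat N ^ CARD('n)"

definition finite_fourier :: "nat \<Rightarrow> real \<Rightarrow> (real ^ 'n \<Rightarrow> real) \<Rightarrow> real ^ 'n \<Rightarrow> complex" where
  "finite_fourier N a f x = (\<Sum>k\<in>frequencies N. fourier_coeff N a f k * fourier_mode a k x)"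

text \<open>The formula makes sense for all \<open>x\<close> and is \<open>2 * S * L\<close>-periodic in each coordinate, so it
  already includes the periodic extension.\<close>

definition padded_fourier ::
    "real \<Rightarrow> real \<Rightarrow> (real ^ 'n \<Rightarrow> real) \<Rightarrow> nat \<Rightarrow> real ^ 'n \<Rightarrow> complex" where
  "padded_fourier S L \<rho> N = finite_fourier N (S * L) (zero_pad L \<rho>)"

text \<open>Spectral accuracy: the uniform error on \<open>A\<close> decays faster than every power of \<open>1 / N\<close>.\<close>

definition spectral_approx ::
    "(real ^ 'n) set \<Rightarrow> (nat \<Rightarrow> real ^ 'n \<Rightarrow> complex) \<Rightarrow> (real ^ 'n \<Rightarrow> real) \<Rightarrow> bool" where
  "spectral_approx A f g \<longleftrightarrow>
     (\<forall>m::nat. \<exists>C::real. \<forall>N>0. \<forall>x\<in>A. norm (f N x - of_real (g x)) \<le> C / real N ^ m)"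

definition potential :: "(real ^ 'n \<Rightarrow> real) \<Rightarrow> (real ^ 'n \<Rightarrow> real) \<Rightarrow> real ^ 'n \<Rightarrow> real" where
  "potential U \<rho> x = (LINT y|lborel. U (x - y) * \<rho> y)"

definition ktm_potential ::
    "real \<Rightarrow> real \<Rightarrow> (real ^ 'n \<Rightarrow> real) \<Rightarrow> (real ^ 'n \<Rightarrow> real) \<Rightarrow> nat \<Rightarrow> real ^ 'n \<Rightarrow> complex" where
  "ktm_potential S L U \<rho> N x =
     (LINT y:trunc_ball L|lborel. of_real (U y) * padded_fourier S L \<rho> N (x - y))"

text \<open>\<open>S\<close>-fold zero-padding provides the approximation of the density on the cube of half-width
  \<open>(2 * sqrt d + 1) * L\<close>, for every density supported in \<open>cube L\<close>.\<close>

definition adequate_padding :: "'n::finite itself \<Rightarrow> real \<Rightarrow> real \<Rightarrow> bool" where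
  "adequate_padding _ L S \<longleftrightarrow>
     (\<forall>\<rho> \<in> densities L :: (real ^ 'n \<Rightarrow> real) set.
        spectral_approx (cube ((2 * sqrt (real CARD('n)) + 1) * L)) (padded_fourier S L \<rho>) \<rho>)"

end

theory Submission
  imports Defs
begin

text \<open>Discrete Fourier coefficients of a smooth, compactly supported \<open>\<rho>\<close> decay rapidly by summation by
  parts. Passing from \<open>N\<close> to \<open>2N\<close> grid points only folds the high frequencies onto lower ones, so
  the interpolants on the nested grids \<open>N, 2N, 4N, \<dots>\<close> differ by rapidly decaying amounts, and they
  are exact on grid points that become dense: this gives spectral accuracy on \<open>cube (S * L)\<close>.
  By periodicity the interpolants approximate the \<open>2 * S * L\<close>-periodic copies of \<open>\<rho>\<close>, which
  coincide with \<open>\<rho>\<close> on \<open>cube ((2 * S - 1) * L)\<close> and no further: for smaller \<open>S\<close> than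
  \<open>sqrt d + 1\<close> a nonnegative bump near a face has a periodic copy that enters the truncated
  convolution and contributes an error that does not tend to zero.\<close>

section \<open>Discrete orthogonality\<close>

text \<open>The coefficients are finite sums of grid values, not integrals, so decay and error are
  both obtained inside the discrete setting. Every frequency that is new after doubling has a
  coordinate of size at least a quarter of the new grid number; there the multiplier of the
  difference operator stays away from 0. The threshold balances two lengths: copies of the support
  begin at \<open>2 * S * L - L\<close>, while the method reads the density out to
  \<open>2 * sqrt d * L + L\<close>. Equality is allowed because a continuous density supported in
  the cube vanishes on its faces. Necessity at the level of potentials must exclude that density
  errors of opposite sign cancel under the integral. Nonnegative densities and positive kernels do
  this: the density error is at least \<open>- C / N\<close> everywhere, and at least a positive
  constant minus \<open>C / N\<close> on a fixed ball. Necessity at the level of densities is then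
  the case of the constant kernel 1.\<close>

lemma sum_cis_roots_of_unity:
  fixes m k0 :: int
  assumes "N > 0"
  shows "(\<Sum>k\<in>{k0..<k0 + int N}. cis (2 * pi * of_int k * of_int m / real N))
    = (if int N dvd m then of_nat N else 0)"
proof -
  \<comment> \<open>The offset \<open>k0\<close> contributes only a common factor in front of the
    geometric sum in \<open>w\<close>. It is left free because frequencies start at
    \<open>- (N div 2)\<close> and grid indices at 0.\<close>
  define w where "w = cis (2 * pi * of_int m / real N)"
  have "(\<Sum>k\<in>{k0..<k0 + int N}. cis (2 * pi * of_int k * of_int m / real N))
      = (\<Sum>t<N. cis (2 * pi * of_int (k0 + int t) * of_int m / real N))"
    by (rule sum.reindex_bij_witness[of _ "\<lambda>t. k0 + int t" "\<lambda>k. nat (k - k0)"]) auto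
  also have "\<dots> = (\<Sum>t<N. cis (2 * pi * of_int k0 * of_int m / real N) * w ^ t)"
    unfolding w_def by (simp add: Complex.DeMoivre cis_mult ring_distribs add_divide_distrib mult_ac)
  also have "\<dots> = cis (2 * pi * of_int k0 * of_int m / real N) * (\<Sum>t<N. w ^ t)"
    by (simp add: sum_distrib_left)
  finally have eq: "(\<Sum>k\<in>{k0..<k0 + int N}. cis (2 * pi * of_int k * of_int m / real N)) = \<dots>" .
  show ?thesis
  proof (cases "int N dvd m")
    case True
    then obtain l where l: "m = int N * l" by (auto elim: dvdE)
    have "cis (2 * pi * of_int k * of_int m / real N) = 1" for k :: int
    proof -
      have "2 * pi * of_int k * of_int m / real N = 2 * pi * of_int (k * l)"
        using assms by (simp add: l)
      then show ?thesis by (simp only: cis_multiple_2pi Ints_of_int)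
    qed
    then show ?thesis using True by simp
  next
    case False
    have "w \<noteq> 1"
    proof
      assume "w = 1"
      then have "cos (2 * pi * of_int m / real N) = 1"
        unfolding w_def by (metis cis.simps(1) one_complex.simps(1))
      then obtain n :: int where "2 * pi * of_int m / real N = of_int n * 2 * pi"
        using cos_one_2pi_int by blast
      then have "of_int m = (of_int n * real N :: real)"
        using assms by (simp add: field_simps)
      then have "m = n * int N"
        by (metis of_int_eq_iff of_int_mult of_int_of_nat_eq)
      with False show False by simp
    qed
    moreover have "w ^ N = 1"
      unfolding w_def using assms by (simp add: Complex.DeMoivre)
    ultimately show ?thesis using False eq by (simp add: geometric_sum)
  qed
qed

section \<open>Sums over boxes of index vectors\<close>

lemma vec_box_bij_betw:
  "bij_betw vec_lambda (PiE UNIV B) {v :: 'b ^ 'n. \<forall>i. v $ i \<in> B i}"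
  by (rule bij_betwI[of _ _ _ vec_nth]) (auto simp: PiE_iff)

text \<open>Vectors are transported to extensional functions, where sum and product can be
  exchanged; this reduces orthogonality in d dimensions to one dimension.\<close>

lemma sum_prod_vec_box:
  fixes f :: "'n::finite \<Rightarrow> 'b \<Rightarrow> 'c::comm_semiring_1"
  assumes "\<And>i. finite (B i)"
  shows "(\<Sum>v\<in>{v :: 'b ^ 'n. \<forall>i. v $ i \<in> B i}. \<Prod>i\<in>UNIV. f i (v $ i)) = (\<Prod>i\<in>UNIV. \<Sum>b\<in>B i. f i b)"
  using assms
  by (subst sum.reindex_bij_betw[OF vec_box_bij_betw, symmetric]) (simp add: prod_sum_PiE)

lemma finite_vec_box:
  assumes "\<And>i. finite (B i)"
  shows "finite {v :: 'b ^ 'n. \<forall>i. v $ i \<in> B i}"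
  using bij_betw_finite[OF vec_box_bij_betw[of B]] assms finite_PiE[of UNIV B] by simp

lemma card_vec_box:
  assumes "finite A"
  shows "card {v :: 'b ^ 'n. \<forall>i. v $ i \<in> A} = card A ^ CARD('n)"
  using bij_betw_same_card[OF vec_box_bij_betw[of "\<lambda>_::'n. A"]] assms
  by (simp add: card_PiE)

lemma grid_indices_box: "grid_indices N = {j :: nat ^ 'n. \<forall>i. j $ i \<in> {..<N}}"
  by (simp add: grid_indices_def)

text \<open>For odd \<open>N\<close> as well, \<open>- (int N div 2)\<close> is the least
  \<open>k\<close> with \<open>- N <= 2 * k\<close>, so each coordinate runs through a full residue
  system modulo \<open>N\<close>.\<close>

lemma frequencies_box:
  "frequencies N = {k :: int ^ 'n. \<forall>i. k $ i \<in> {- (int N div 2)..<- (int N div 2) + int N}}"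
proof -
  have "(- int N \<le> 2 * k \<and> 2 * k < int N) \<longleftrightarrow> k \<in> {- (int N div 2)..<- (int N div 2) + int N}" for k
    unfolding atLeastLessThan_iff by linarith
  then show ?thesis unfolding frequencies_def by simp
qed

lemma finite_grid_indices: "finite (grid_indices N :: (nat ^ 'n) set)"
  unfolding grid_indices_box by (rule finite_vec_box) simp

lemma finite_frequencies: "finite (frequencies N :: (int ^ 'n) set)"
  unfolding frequencies_box by (rule finite_vec_box) simp

lemma card_frequencies: "card (frequencies N :: (int ^ 'n) set) = N ^ CARD('n)"
  unfolding frequencies_box by (subst card_vec_box) auto

lemma cis_sum: "finite A \<Longrightarrow> cis (\<Sum>i\<in>A. f i) = (\<Prod>i\<in>A. cis (f i))"
  by (induction A rule: finite_induct) (auto simp: cis_mult[symmetric])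

lemma fourier_mode_add: "fourier_mode a k (x + y) = fourier_mode a k x * fourier_mode a k y"
  by (simp add: fourier_mode_def cis_mult ring_distribs sum.distrib)

lemma norm_fourier_mode [simp]: "norm (fourier_mode a k x) = 1"
  by (simp add: fourier_mode_def)

text \<open>Stated for two frequencies and two grid points so that both orthogonality relations are
  instances. The factors \<open>cis (- pi * ...)\<close> are signs that arise because the grid
  starts at \<open>- a\<close> and not at 0.\<close>

lemma fourier_mode_grid_difference:
  fixes k q :: "int ^ 'n" and j j' :: "nat ^ 'n"
  assumes "a > 0" "N > 0"
  shows "fourier_mode a q (grid_point N a j) * cnj (fourier_mode a k (grid_point N a j'))
   = (\<Prod>i\<in>UNIV. cis (- pi * of_int (q $ i - k $ i)) *
       cis (2 * pi * (of_int (q $ i) * real (j $ i) - of_int (k $ i) * real (j' $ i)) / real N))"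
proof -
  have "pi / a * (\<Sum>i\<in>UNIV. of_int (q $ i) * grid_point N a j $ i)
     - pi / a * (\<Sum>i\<in>UNIV. of_int (k $ i) * grid_point N a j' $ i)
     = (\<Sum>i\<in>UNIV. - pi * of_int (q $ i - k $ i) +
      2 * pi * (of_int (q $ i) * real (j $ i) - of_int (k $ i) * real (j' $ i)) / real N)"
    unfolding right_diff_distrib[symmetric] sum_subtractf[symmetric] sum_distrib_left
    by (rule sum.cong) (use assms in \<open>auto simp: grid_point_def field_simps\<close>)
  then have "fourier_mode a q (grid_point N a j) * cnj (fourier_mode a k (grid_point N a j'))
    = cis \<dots>"
    by (simp add: fourier_mode_def cis_cnj cis_mult)
  then show ?thesis by (simp only: cis_sum[OF finite_class.finite_UNIV] cis_mult)
qed

lemma fourier_mode_orthogonal_frequencies: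
  fixes j j' :: "nat ^ 'n"
  assumes "a > 0" "N > 0" "j \<in> grid_indices N" "j' \<in> grid_indices N"
  shows "(\<Sum>k\<in>frequencies N. fourier_mode a k (grid_point N a j) * cnj (fourier_mode a k (grid_point N a j')))
    = (if j = j' then of_nat N ^ CARD('n) else 0)"
proof -
  have dvd: "int N dvd int (j $ i) - int (j' $ i) \<longleftrightarrow> j $ i = j' $ i" for i
  proof
    assume "int N dvd int (j $ i) - int (j' $ i)"
    then have "int (j $ i) mod int N = int (j' $ i) mod int N" by (simp add: mod_eq_dvd_iff)
    moreover have "j $ i < N" "j' $ i < N" using assms by (auto simp: grid_indices_def)
    ultimately show "j $ i = j' $ i" by simp
  qed simp
  have "(\<Sum>k\<in>frequencies N. fourier_mode a k (grid_point N a j) * cnj (fourier_mode a k (grid_point N a j')))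
    = (\<Sum>k\<in>frequencies N. \<Prod>i\<in>UNIV. cis (2 * pi * of_int (k $ i) * of_int (int (j $ i) - int (j' $ i)) / real N))"
    by (simp add: fourier_mode_grid_difference[OF assms(1,2)] right_diff_distrib mult.assoc)
  also have "\<dots> = (\<Prod>i\<in>UNIV. \<Sum>k\<in>{- (int N div 2)..<- (int N div 2) + int N}.
       cis (2 * pi * of_int k * of_int (int (j $ i) - int (j' $ i)) / real N))"
    unfolding frequencies_box by (rule sum_prod_vec_box) simp
  also have "\<dots> = (\<Prod>i\<in>UNIV. if j $ i = j' $ i then of_nat N else 0)"
    by (simp only: sum_cis_roots_of_unity[OF assms(2)] dvd)
  also have "\<dots> = (if j = j' then of_nat N ^ CARD('n) else 0)"
    by (auto simp: vec_eq_iff)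
  finally show ?thesis .
qed

text \<open>Only congruence modulo \<open>N\<close> survives, since \<open>q\<close> need not lie in
  \<open>frequencies N\<close>: the grid cannot tell congruent frequencies apart, except for the
  sign due to its origin.\<close>

lemma fourier_mode_orthogonal_grid:
  fixes k q :: "int ^ 'n"
  assumes "a > 0" "N > 0"
  shows "(\<Sum>j\<in>grid_indices N. fourier_mode a q (grid_point N a j) * cnj (fourier_mode a k (grid_point N a j)))
    = (if \<forall>i. int N dvd q $ i - k $ i
       then (\<Prod>i\<in>UNIV. cis (- pi * of_int (q $ i - k $ i))) * of_nat N ^ CARD('n) else 0)"
proof -
  have "(\<Sum>j\<in>grid_indices N. fourier_mode a q (grid_point N a j) * cnj (fourier_mode a k (grid_point N a j)))
    = (\<Sum>j\<in>grid_indices N. \<Prod>i\<in>UNIV. cis (- pi * of_int (q $ i - k $ i)) *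
        cis (2 * pi * real (j $ i) * of_int (q $ i - k $ i) / real N))"
    by (simp add: fourier_mode_grid_difference[OF assms] algebra_simps)
  also have "\<dots> = (\<Prod>i\<in>UNIV. \<Sum>j\<in>{..<N}. cis (- pi * of_int (q $ i - k $ i)) *
        cis (2 * pi * real j * of_int (q $ i - k $ i) / real N))"
    unfolding grid_indices_box
    by (rule sum_prod_vec_box[where f = "\<lambda>i j. cis (- pi * of_int (q $ i - k $ i)) *
        cis (2 * pi * real j * of_int (q $ i - k $ i) / real N)"]) simp
  also have "\<dots> = (\<Prod>i\<in>UNIV. cis (- pi * of_int (q $ i - k $ i)) *
      (if int N dvd q $ i - k $ i then of_nat N else 0))"
  proof (rule prod.cong[OF refl])
    fix i
    have "(\<Sum>j<N. cis (2 * pi * real j * of_int (q $ i - k $ i) / real N))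
      = (\<Sum>l\<in>{0..<0 + int N}. cis (2 * pi * of_int l * of_int (q $ i - k $ i) / real N))"
      by (rule sum.reindex_bij_witness[of _ nat int]) auto
    then show "(\<Sum>j<N. cis (- pi * of_int (q $ i - k $ i)) *
        cis (2 * pi * real j * of_int (q $ i - k $ i) / real N))
      = cis (- pi * of_int (q $ i - k $ i)) * (if int N dvd q $ i - k $ i then of_nat N else 0)"
      by (simp only: sum_distrib_left[symmetric] sum_cis_roots_of_unity[OF assms(2)])
  qed
  also have "\<dots> = (if \<forall>i. int N dvd q $ i - k $ i
       then (\<Prod>i\<in>UNIV. cis (- pi * of_int (q $ i - k $ i))) * of_nat N ^ CARD('n) else 0)"
    by (auto simp: prod.distrib)
  finally show ?thesis .
qed

section \<open>Trigonometric interpolation and aliasing\<close>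

lemma finite_fourier_grid_point:
  fixes j :: "nat ^ 'n"
  assumes "a > 0" "N > 0" "j \<in> grid_indices N"
  shows "finite_fourier N a f (grid_point N a j) = of_real (f (grid_point N a j))"
proof -
  have "finite_fourier N a f (grid_point N a j) =
    (\<Sum>k\<in>frequencies N. \<Sum>j'\<in>grid_indices N. of_real (f (grid_point N a j')) / of_nat N ^ CARD('n)
      * (fourier_mode a k (grid_point N a j) * cnj (fourier_mode a k (grid_point N a j'))))"
    unfolding finite_fourier_def fourier_coeff_def sum_divide_distrib sum_distrib_right
    by (simp add: mult_ac)
  also have "\<dots> = (\<Sum>j'\<in>grid_indices N. of_real (f (grid_point N a j')) / of_nat N ^ CARD('n)
      * (\<Sum>k\<in>frequencies N. fourier_mode a k (grid_point N a j) * cnj (fourier_mode a k (grid_point N a j'))))"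
    by (subst sum.swap) (simp add: sum_distrib_left)
  also have "\<dots> = (\<Sum>j'\<in>grid_indices N. if j' = j then of_real (f (grid_point N a j')) else 0)"
    by (rule sum.cong[OF refl])
      (use assms in \<open>auto simp: fourier_mode_orthogonal_frequencies\<close>)
  also have "\<dots> = of_real (f (grid_point N a j))"
    using assms(3) by (simp add: finite_grid_indices)
  finally show ?thesis .
qed

text \<open>The grid interpolant of the single mode \<open>q\<close>: up to sign, it is the mode in
  \<open>frequencies N\<close> that is congruent to \<open>q\<close> modulo \<open>N\<close>.\<close>

definition aliased_mode :: "nat \<Rightarrow> real \<Rightarrow> int ^ 'n \<Rightarrow> real ^ 'n \<Rightarrow> complex" where
  "aliased_mode N a q x = (\<Sum>k\<in>frequencies N. fourier_mode a k x *
     ((\<Sum>j\<in>grid_indices N. fourier_mode a q (grid_point N a j) * cnj (fourier_mode a k (grid_point N a j)))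
      / of_nat N ^ CARD('n)))"

lemma frequencies_congruent_eq:
  fixes k k' :: "int ^ 'n"
  assumes "k \<in> frequencies N" "k' \<in> frequencies N" "\<And>i. int N dvd k $ i - k' $ i"
  shows "k = k'"
proof -
  have "k $ i = k' $ i" for i
  proof -
    have "- int N \<le> 2 * k $ i" "2 * k $ i < int N" "- int N \<le> 2 * k' $ i" "2 * k' $ i < int N"
      using assms(1,2) by (auto simp: frequencies_def)
    then have "\<bar>k $ i - k' $ i\<bar> < int N" by linarith
    then show ?thesis using assms(3)[of i] dvd_imp_le_int[of "k $ i - k' $ i" "int N"] by force
  qed
  then show ?thesis by (simp add: vec_eq_iff)
qed

lemma aliased_mode_eq:
  assumes "a > 0" "N > 0"
  shows "aliased_mode N a q x = (\<Sum>k | k \<in> frequencies N \<and> (\<forall>i. int N dvd q $ i - k $ i).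
     fourier_mode a k x * (\<Prod>i\<in>UNIV. cis (- pi * of_int (q $ i - k $ i))))"
  unfolding aliased_mode_def fourier_mode_orthogonal_grid[OF assms]
  using assms(2) by (subst sum.inter_filter[OF finite_frequencies]) (auto intro!: sum.cong)

text \<open>At most one element of \<open>frequencies N\<close> is congruent to \<open>q\<close>, so
  the sum has at most one term, and that term is unimodular.\<close>

lemma norm_aliased_mode_le:
  fixes q :: "int ^ 'n"
  assumes "a > 0" "N > 0"
  shows "norm (aliased_mode N a q x) \<le> 1"
proof -
  let ?K = "{k. k \<in> frequencies N \<and> (\<forall>i. int N dvd q $ i - k $ i)}"
  have fin: "finite ?K" by (rule finite_subset[OF _ finite_frequencies[of N]]) auto
  have "k = k'" if "k \<in> ?K" "k' \<in> ?K" for k k'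
  proof (rule frequencies_congruent_eq)
    fix i
    have "int N dvd (q $ i - k' $ i) - (q $ i - k $ i)" using that by (blast intro: dvd_diff)
    then show "int N dvd k $ i - k' $ i" by simp
  qed (use that in auto)
  then have "card ?K \<le> Suc 0" using fin by (subst card_le_Suc0_iff_eq) auto
  moreover have "norm (aliased_mode N a q x) \<le> (\<Sum>k\<in>?K. 1)"
    unfolding aliased_mode_eq[OF assms]
    by (rule sum_norm_le) (simp add: norm_mult prod_norm[symmetric])
  ultimately show ?thesis by simp
qed

lemma aliased_mode_frequency:
  assumes "a > 0" "N > 0" "q \<in> frequencies N"
  shows "aliased_mode N a q x = fourier_mode a q x"
proof -
  have "{k. k \<in> frequencies N \<and> (\<forall>i. int N dvd q $ i - k $ i)} = {q}"
    using assms(3) frequencies_congruent_eq[OF assms(3)] by auto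
  then show ?thesis by (simp add: aliased_mode_eq[OF assms(1,2)])
qed

lemma grid_point_double: "grid_point N a j = grid_point (2 * N) a (\<chi> i. 2 * j $ i)"
  by (simp add: grid_point_def vec_eq_iff)

text \<open>Points of the coarse grid are the even-indexed points of the fine one, where the fine
  interpolant reproduces \<open>f\<close>. Expanding the coarse grid values in fine modes and using
  linearity interpolates each mode separately.\<close>

lemma finite_fourier_aliasing:
  fixes x :: "real ^ 'n"
  assumes "a > 0" "N > 0"
  shows "finite_fourier N a f x
    = (\<Sum>q\<in>frequencies (2 * N). fourier_coeff (2 * N) a f q * aliased_mode N a q x)"
proof -
  have val: "of_real (f (grid_point N a j)) =
    (\<Sum>q\<in>frequencies (2 * N). fourier_coeff (2 * N) a f q * fourier_mode a q (grid_point N a j))"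
    if "j \<in> grid_indices N" for j
  proof -
    have "(\<chi> i. 2 * j $ i) \<in> grid_indices (2 * N)" using that by (simp add: grid_indices_def)
    then show ?thesis
      using finite_fourier_grid_point[of a "2 * N" "\<chi> i. 2 * j $ i" f] assms
      by (simp add: grid_point_double[symmetric] finite_fourier_def)
  qed
  have "finite_fourier N a f x = (\<Sum>k\<in>frequencies N. \<Sum>j\<in>grid_indices N. \<Sum>q\<in>frequencies (2 * N).
     fourier_coeff (2 * N) a f q * (fourier_mode a q (grid_point N a j) *
      cnj (fourier_mode a k (grid_point N a j)) / of_nat N ^ CARD('n) * fourier_mode a k x))"
    unfolding finite_fourier_def[of N] fourier_coeff_def[of N] sum_divide_distrib sum_distrib_right
    by (intro sum.cong refl) (simp add: val sum_distrib_left sum_distrib_right sum_divide_distrib mult_ac)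
  also have "\<dots> = (\<Sum>k\<in>frequencies N. \<Sum>q\<in>frequencies (2 * N). \<Sum>j\<in>grid_indices N.
     fourier_coeff (2 * N) a f q * (fourier_mode a q (grid_point N a j) *
      cnj (fourier_mode a k (grid_point N a j)) / of_nat N ^ CARD('n) * fourier_mode a k x))"
    by (intro sum.cong refl) (rule sum.swap)
  also have "\<dots> = (\<Sum>q\<in>frequencies (2 * N). \<Sum>k\<in>frequencies N. \<Sum>j\<in>grid_indices N.
     fourier_coeff (2 * N) a f q * (fourier_mode a q (grid_point N a j) *
      cnj (fourier_mode a k (grid_point N a j)) / of_nat N ^ CARD('n) * fourier_mode a k x))"
    by (rule sum.swap)
  also have "\<dots> = (\<Sum>q\<in>frequencies (2 * N). fourier_coeff (2 * N) a f q * aliased_mode N a q x)"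
    unfolding aliased_mode_def sum_distrib_left sum_divide_distrib by (simp add: mult_ac)
  finally show ?thesis .
qed

text \<open>Modes in \<open>frequencies N\<close> are reproduced and cancel in the difference. Each
  remaining mode contributes at most twice its coefficient, and there are at most
  \<open>(2 * N) ^ d\<close> of them.\<close>

lemma finite_fourier_doubling:
  fixes x :: "real ^ 'n"
  assumes "a > 0" "N > 0"
    and B: "\<And>q :: int ^ 'n. q \<in> frequencies (2 * N) \<Longrightarrow> q \<notin> frequencies N \<Longrightarrow>
      norm (fourier_coeff (2 * N) a f q) \<le> B"
    and "0 \<le> B"
  shows "norm (finite_fourier (2 * N) a f x - finite_fourier N a f x) \<le> 2 * B * real (2 * N) ^ CARD('n)"
proof -
  have "norm (fourier_coeff (2 * N) a f q * (fourier_mode a q x - aliased_mode N a q x)) \<le> 2 * B"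
    if "q \<in> frequencies (2 * N)" for q
  proof (cases "q \<in> frequencies N")
    case True
    then show ?thesis using assms by (simp add: aliased_mode_frequency)
  next
    case False
    have "norm (fourier_mode a q x - aliased_mode N a q x) \<le> 1 + 1"
      using norm_aliased_mode_le[OF assms(1,2)]
      by (intro order_trans[OF norm_triangle_ineq4] add_mono) auto
    then have "norm (fourier_coeff (2 * N) a f q) * norm (fourier_mode a q x - aliased_mode N a q x) \<le> B * 2"
      using B[OF that False] assms(4) by (intro mult_mono) auto
    then show ?thesis by (simp add: norm_mult mult.commute)
  qed
  then have "norm (\<Sum>q\<in>frequencies (2 * N). fourier_coeff (2 * N) a f q * (fourier_mode a q x - aliased_mode N a q x))
    \<le> (\<Sum>q\<in>(frequencies (2 * N) :: (int ^ 'n) set). 2 * B)"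
    by (rule sum_norm_le)
  then show ?thesis
    unfolding finite_fourier_aliasing[OF assms(1,2)] unfolding finite_fourier_def
    by (simp add: card_frequencies sum_subtractf right_diff_distrib mult_ac)
qed

section \<open>Decay of the discrete Fourier coefficients\<close>

definition dir_deriv :: "real ^ 'n \<Rightarrow> (real ^ 'n \<Rightarrow> real) \<Rightarrow> real ^ 'n \<Rightarrow> real" where
  "dir_deriv v f = (\<lambda>x. frechet_derivative f (at x) v)"

definition forward_diff :: "real ^ 'n \<Rightarrow> (real ^ 'n \<Rightarrow> real) \<Rightarrow> real ^ 'n \<Rightarrow> real" where
  "forward_diff v f x = f (x + v) - f x"

lemma smooth_differentiable:
  assumes "smooth f"
  shows "f differentiable (at x)"
proof -
  have "cont_diff (Suc 0) f" using assms unfolding smooth_def ..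
  then show ?thesis by simp
qed

lemma smooth_continuous_on:
  assumes "smooth f"
  shows "continuous_on A f"
proof -
  have "cont_diff 0 f" using assms unfolding smooth_def ..
  then show ?thesis by (auto intro: continuous_on_subset)
qed

lemma smooth_dir_deriv:
  assumes "smooth f"
  shows "smooth (dir_deriv v f)"
  unfolding smooth_def dir_deriv_def
proof
  fix k
  have "cont_diff (Suc k) f" using assms unfolding smooth_def ..
  then show "cont_diff k (\<lambda>x. frechet_derivative f (at x) v)" by simp
qed

lemma forward_diff_Suc:
  "(forward_diff u ^^ Suc m) f x = (forward_diff u ^^ m) f (x + u) - (forward_diff u ^^ m) f x"
  using forward_diff_def[of u "(forward_diff u ^^ m) f" x] by simp

text \<open>Differences are linear and translation invariant, hence commute with
  differentiation.\<close>

lemma forward_diff_iterate_has_derivative: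
  assumes "\<And>x. f differentiable (at x)"
  shows "((forward_diff u ^^ m) f has_derivative (\<lambda>v. (forward_diff u ^^ m) (dir_deriv v f) x)) (at x)"
proof (induction m arbitrary: x)
  case 0
  then show ?case using assms by (simp add: dir_deriv_def frechet_derivative_works[symmetric])
next
  case (Suc m)
  let ?g = "(forward_diff u ^^ m) f"
  have "((\<lambda>y. ?g (y + u)) has_derivative (\<lambda>v. (forward_diff u ^^ m) (dir_deriv v f) (x + u))) (at x)"
    by (rule has_derivative_compose[where f = "\<lambda>y. y + u" and f' = "\<lambda>v. v", OF _ Suc.IH[of "x + u"]])
      (auto intro!: derivative_eq_intros)
  from has_derivative_diff[OF this Suc.IH[of x]] show ?case
    unfolding forward_diff_Suc .
qed

text \<open>The mean value theorem trades the outermost difference for \<open>h\<close> times a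
  derivative. By commutation the other \<open>m\<close> differences act on
  \<open>dir_deriv v f\<close>, to which the induction hypothesis applies; hence \<open>f\<close> is
  generalized.\<close>

lemma forward_diff_iterate_bound:
  fixes f :: "real ^ 'n \<Rightarrow> real"
  assumes "smooth f" "0 \<le> h" "\<And>x. \<bar>(dir_deriv v ^^ m) f x\<bar> \<le> B"
  shows "\<bar>(forward_diff (h *\<^sub>R v) ^^ m) f x\<bar> \<le> h ^ m * B"
  using assms(1,3)
proof (induction m arbitrary: f x)
  case 0
  then show ?case by simp
next
  case (Suc m)
  let ?D = "forward_diff (h *\<^sub>R v) ^^ m"
  have bound: "\<bar>?D (dir_deriv v f) y\<bar> \<le> h ^ m * B" for y
    using Suc.IH[OF smooth_dir_deriv[OF Suc.prems(1)], of v] Suc.prems(2)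
    by (simp add: funpow_swap1)
  have line: "((\<lambda>t. ?D f (x + t *\<^sub>R (h *\<^sub>R v))) has_real_derivative h * ?D (dir_deriv v f) (x + t *\<^sub>R (h *\<^sub>R v))) (at t)" for t
  proof -
    note der = forward_diff_iterate_has_derivative[OF smooth_differentiable[OF Suc.prems(1)], where u = "h *\<^sub>R v" and m = m]
    have "((\<lambda>t. ?D f (x + t *\<^sub>R (h *\<^sub>R v))) has_derivative
        (\<lambda>s. ?D (dir_deriv (s *\<^sub>R (h *\<^sub>R v)) f) (x + t *\<^sub>R (h *\<^sub>R v)))) (at t)"
      by (rule has_derivative_compose[OF _ der]) (auto intro!: derivative_eq_intros)
    moreover have "(\<lambda>s. ?D (dir_deriv (s *\<^sub>R (h *\<^sub>R v)) f) y) = (*) (h * ?D (dir_deriv v f) y)" for y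
      using linear_scale[OF has_derivative_linear[OF der[of y]], of "s * h" v for s]
      by (simp add: fun_eq_iff)
    ultimately show ?thesis unfolding has_field_derivative_def by metis
  qed
  obtain z where "?D f (x + 1 *\<^sub>R (h *\<^sub>R v)) - ?D f (x + 0 *\<^sub>R (h *\<^sub>R v))
      = (1 - 0) * (h * ?D (dir_deriv v f) (x + z *\<^sub>R (h *\<^sub>R v)))"
    using MVT2[of 0 1, OF _ line] by auto
  then have "\<bar>(forward_diff (h *\<^sub>R v) ^^ Suc m) f x\<bar> = h * \<bar>?D (dir_deriv v f) (x + z *\<^sub>R (h *\<^sub>R v))\<bar>"
    unfolding forward_diff_Suc using assms(2) by (simp add: abs_mult)
  also have "\<dots> \<le> h * (h ^ m * B)" by (rule mult_left_mono[OF bound assms(2)])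
  finally show ?case by simp
qed

lemma dir_deriv_iterate_outside:
  assumes "closed K" "\<And>x. x \<notin> K \<Longrightarrow> f x = 0" "x \<notin> K"
  shows "(dir_deriv v ^^ m) f x = 0"
  using assms(3)
proof (induction m arbitrary: x)
  case 0
  then show ?case using assms(2) by simp
next
  case (Suc m)
  have "((dir_deriv v ^^ m) f has_derivative (\<lambda>_. 0)) (at x)"
    by (rule has_derivative_transform_within_open[where f = "\<lambda>_. 0" and s = "- K"])
      (use assms(1) Suc in \<open>auto intro!: derivative_eq_intros simp: Suc.IH\<close>)
  from frechet_derivative_at[OF this] have "frechet_derivative ((dir_deriv v ^^ m) f) (at x) v = 0" by metis
  then show ?case using fun_cong[OF dir_deriv_def[of v "(dir_deriv v ^^ m) f"], of x] by simp
qed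

section \<open>The cube and its densities\<close>

lemma mem_cube: "x \<in> cube a \<longleftrightarrow> (\<forall>i. \<bar>x $ i\<bar> \<le> a)"
  by (simp add: cube_def mem_box_cart abs_le_iff) (metis minus_le_iff)

lemma compact_cube: "compact (cube a)"
  by (simp add: cube_def compact_cbox)

lemma densities_smooth: "\<rho> \<in> densities L \<Longrightarrow> smooth \<rho>"
  by (simp add: densities_def)

lemma densities_outside: "\<rho> \<in> densities L \<Longrightarrow> x \<notin> cube L \<Longrightarrow> \<rho> x = 0"
  using closure_subset[of "{x. \<rho> x \<noteq> 0}"] by (auto simp: densities_def)

text \<open>The faces are the point: a nonzero value there would persist, by continuity, slightly
  outside the cube. This is what admits equality in the padding condition.\<close>

lemma densities_outside_interior:
  assumes "\<rho> \<in> densities L" "L \<le> \<bar>x $ i\<bar>"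
  shows "\<rho> x = 0"
proof (rule ccontr)
  assume "\<rho> x \<noteq> 0"
  have cont: "continuous_on UNIV \<rho>" using assms(1) by (intro smooth_continuous_on densities_smooth)
  have "open (\<rho> -` (- {0}))" by (rule open_vimage[OF _ cont]) auto
  then obtain e where e: "e > 0" "\<And>y. dist y x < e \<Longrightarrow> \<rho> y \<noteq> 0"
    using \<open>\<rho> x \<noteq> 0\<close> by (auto simp: open_dist)
  \<comment> \<open>A step of length \<open>e / 2\<close> outward along axis \<open>i\<close>: short
    enough to keep the density nonzero, and leaving the cube.\<close>
  define y where "y = x + ((if x $ i < 0 then - 1 else 1) * (e / 2)) *\<^sub>R axis i 1"
  have "dist y x = e / 2" using e(1) by (simp add: y_def dist_norm norm_axis_1)
  then have "y \<in> cube L" using e densities_outside[OF assms(1), of y] by force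
  then have "\<bar>y $ i\<bar> \<le> L" by (simp add: mem_cube)
  moreover have "\<bar>y $ i\<bar> = \<bar>x $ i\<bar> + e / 2"
    using e(1) by (auto simp: y_def axis_def)
  ultimately show False using assms(2) e(1) by simp
qed

lemma densities_dir_deriv_bounded:
  assumes "\<rho> \<in> densities L"
  obtains B where "0 \<le> B" "\<And>x. \<bar>(dir_deriv v ^^ m) \<rho> x\<bar> \<le> B"
proof -
  have sm: "smooth ((dir_deriv v ^^ m) \<rho>)"
    by (induction m) (use assms in \<open>auto intro: smooth_dir_deriv densities_smooth\<close>)
  have "bounded ((dir_deriv v ^^ m) \<rho> ` cube L)"
    by (intro compact_imp_bounded compact_continuous_image smooth_continuous_on sm compact_cube)
  then obtain B where B: "\<forall>x\<in>cube L. \<bar>(dir_deriv v ^^ m) \<rho> x\<bar> \<le> B"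
    by (auto simp: bounded_iff)
  have "(dir_deriv v ^^ m) \<rho> x = 0" if "x \<notin> cube L" for x
    by (rule dir_deriv_iterate_outside[OF compact_imp_closed[OF compact_cube] densities_outside[OF assms] that])
  with B have "\<bar>(dir_deriv v ^^ m) \<rho> x\<bar> \<le> \<bar>B\<bar>" for x
    by (cases "x \<in> cube L") force+
  then show thesis by (rule that[rotated]) simp
qed

text \<open>The grid is extended to an infinite lattice, so that shifting it is a bijection and summation
  by parts has no boundary terms.\<close>

definition lattice_point :: "nat \<Rightarrow> real \<Rightarrow> int ^ 'n \<Rightarrow> real ^ 'n" where
  "lattice_point N a j = (\<chi> i. - a + 2 * a * of_int (j $ i) / real N)"

definition lattice_transform :: "nat \<Rightarrow> real \<Rightarrow> int ^ 'n \<Rightarrow> (real ^ 'n \<Rightarrow> real) \<Rightarrow> complex" where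
  "lattice_transform N a q f =
     (\<Sum>\<^sub>\<infinity>j\<in>UNIV. of_real (f (lattice_point N a j)) * cnj (fourier_mode a q (lattice_point N a j)))"

text \<open>Ensures summability, without which \<open>infsum\<close> would default to 0 and could
  not be split.\<close>

definition finite_lattice_support :: "nat \<Rightarrow> real \<Rightarrow> (real ^ 'n \<Rightarrow> real) \<Rightarrow> bool" where
  "finite_lattice_support N a f \<longleftrightarrow> finite {j. f (lattice_point N a j) \<noteq> 0}"

lemma lattice_point_shift:
  "lattice_point N a (j + axis i 1) = lattice_point N a j + (2 * a / real N) *\<^sub>R axis i 1"
  by (simp add: lattice_point_def vec_eq_iff axis_def field_simps add_divide_distrib)

text \<open>The discrete form of the rule that differentiation becomes multiplication: reindexing by
  one lattice step turns a shift of \<open>f\<close> into the unimodular factor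
  \<open>fourier_mode a q u\<close>.\<close>

lemma lattice_transform_forward_diff:
  fixes q :: "int ^ 'n" and i :: "'n"
  assumes "a > 0" "N > 0" "finite_lattice_support N a f"
  defines "u \<equiv> (2 * a / real N) *\<^sub>R axis i 1"
  shows "finite_lattice_support N a (forward_diff u f)"
    and "lattice_transform N a q (forward_diff u f)
       = (cis (2 * pi * of_int (q $ i) / real N) - 1) * lattice_transform N a q f"
proof -
  let ?g = "lattice_point N a :: int ^ 'n \<Rightarrow> _"
  let ?w = "cis (2 * pi * of_int (q $ i) / real N)"
  let ?F = "\<lambda>j. of_real (f (?g j)) * cnj (fourier_mode a q (?g j))"
  have bij: "bij (\<lambda>j :: int ^ 'n. j + axis i 1)" by (rule bij_plus_right)
  have fin: "finite {j. f (?g j) \<noteq> 0}" using assms(3) by (simp add: finite_lattice_support_def)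
  have "{j. f (?g (j + axis i 1)) \<noteq> 0} = (\<lambda>j. j + axis i 1) -` {j. f (?g j) \<noteq> 0}" by auto
  then have fin': "finite {j. f (?g (j + axis i 1)) \<noteq> 0}"
    using finite_vimageI[OF fin bij_is_inj[OF bij]] by simp
  have gu: "?g j + u = ?g (j + axis i 1)" for j by (simp add: lattice_point_shift u_def)
  show "finite_lattice_support N a (forward_diff u f)"
    unfolding finite_lattice_support_def 
    by (rule finite_subset[OF _ finite_UnI[OF fin fin']]) (auto simp: forward_diff_def gu)
  have w: "fourier_mode a q u = ?w"
  proof -
    have "(\<Sum>l\<in>UNIV. of_int (q $ l) * u $ l) = (\<Sum>l\<in>UNIV. if l = i then of_int (q $ i) * (2 * a / real N) else 0)"
      by (rule sum.cong) (auto simp: u_def axis_def)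
    then show ?thesis using assms(1) by (simp add: fourier_mode_def field_simps)
  qed
  have sF: "?F summable_on UNIV"
    by (rule finite_nonzero_values_imp_summable_on, rule finite_subset[OF _ fin]) auto
  have sF': "(\<lambda>j. ?F (j + axis i 1)) summable_on UNIV"
    by (rule finite_nonzero_values_imp_summable_on, rule finite_subset[OF _ fin']) auto
  have shift: "(\<Sum>\<^sub>\<infinity>j\<in>UNIV. ?F (j + axis i 1)) = lattice_transform N a q f"
    unfolding lattice_transform_def using infsum_reindex_bij_betw[OF bij, of ?F] by simp
  have summand: "of_real (forward_diff u f (?g j)) * cnj (fourier_mode a q (?g j)) = ?w * ?F (j + axis i 1) + (- 1) * ?F j" for j
  proof -
    have "fourier_mode a q (?g (j + axis i 1)) = fourier_mode a q (?g j) * ?w"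
      by (simp only: gu[symmetric] fourier_mode_add w)
    moreover have "?w * cnj ?w = 1" by (simp add: cis_cnj cis_mult)
    ultimately have "?w * cnj (fourier_mode a q (?g (j + axis i 1))) = cnj (fourier_mode a q (?g j))"
      by (simp add: mult_ac)
    moreover have "of_real (forward_diff u f (?g j)) = (of_real (f (?g (j + axis i 1))) - of_real (f (?g j)) :: complex)"
      by (simp only: forward_diff_def gu of_real_diff)
    ultimately show ?thesis by (metis (no_types, lifting) diff_conv_add_uminus left_diff_distrib mult.left_commute mult_minus1)
  qed
  have "lattice_transform N a q (forward_diff u f) = (\<Sum>\<^sub>\<infinity>j\<in>UNIV. ?w * ?F (j + axis i 1) + (- 1) * ?F j)"
    unfolding lattice_transform_def summand ..
  also have "\<dots> = ?w * (\<Sum>\<^sub>\<infinity>j\<in>UNIV. ?F (j + axis i 1)) + (- 1) * (\<Sum>\<^sub>\<infinity>j\<in>UNIV. ?F j)"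
    by (simp only: infsum_add[OF summable_on_cmult_right[OF sF'] summable_on_cmult_right[OF sF]] infsum_cmult_right')
  finally show "lattice_transform N a q (forward_diff u f) = (?w - 1) * lattice_transform N a q f"
    unfolding shift by (simp add: lattice_transform_def[symmetric] ring_distribs)
qed

lemma lattice_transform_forward_diff_iterate:
  fixes q :: "int ^ 'n" and i :: "'n"
  assumes "a > 0" "N > 0" "finite_lattice_support N a f"
  defines "u \<equiv> (2 * a / real N) *\<^sub>R axis i 1"
  shows "finite_lattice_support N a ((forward_diff u ^^ m) f) \<and>
     lattice_transform N a q ((forward_diff u ^^ m) f)
       = (cis (2 * pi * of_int (q $ i) / real N) - 1) ^ m * lattice_transform N a q f"
proof (induction m)
  case (Suc m)
  with lattice_transform_forward_diff(1)[OF assms(1,2), where f = "(forward_diff u ^^ m) f" and i = i]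
    lattice_transform_forward_diff(2)[OF assms(1,2), where f = "(forward_diff u ^^ m) f" and i = i and q = q] show ?case
    unfolding u_def by simp
qed (simp add: assms(3))

text \<open>The cosine is nonpositive on this range, so the real part alone gives the bound. This
  makes the multiplier of summation by parts harmless to divide by.\<close>

lemma norm_cis_minus_one_ge:
  assumes "pi / 2 \<le> \<bar>t\<bar>" "\<bar>t\<bar> \<le> pi"
  shows "1 \<le> norm (cis t - 1)"
proof -
  have "cos \<bar>t\<bar> \<le> cos (pi / 2)" using assms by (intro cos_monotone_0_pi_le) auto
  then have "cos t \<le> 0" by (simp add: abs_if split: if_splits)
  then have "1 \<le> \<bar>Re (cis t - 1)\<bar>" by simp
  then show ?thesis using abs_Re_le_cmod order_trans by blast
qed

text \<open>Each forward difference looks one step to the right, so the support can grow by one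
  index to the left. For \<open>m = 0\<close>, \<open>L < a\<close> keeps the support strictly
  inside the index range of the grid.\<close>

lemma densities_lattice_support:
  fixes j :: "int ^ 'n"
  assumes "\<rho> \<in> densities L" "L < a" "0 < L" "N > 0"
    and "(forward_diff ((2 * a / real N) *\<^sub>R axis i 1) ^^ m) \<rho> (lattice_point N a j) \<noteq> 0"
  shows "j $ l \<in> {- int m..<int N}"
  using assms(5)
proof (induction m arbitrary: j)
  case 0
  then have "lattice_point N a j \<in> cube L" using densities_outside[OF assms(1)] by auto
  then have b: "\<bar>- a + 2 * a * of_int (j $ l) / real N\<bar> \<le> L" by (auto simp: mem_cube lattice_point_def)
  have "0 < 2 * a * of_int (j $ l) / real N" "2 * a * of_int (j $ l) / real N < 2 * a"
    using b assms(2) by linarith+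
  then have "0 < (of_int (j $ l) :: real)" "(of_int (j $ l) :: real) < of_int (int N)"
    using assms by (auto simp: zero_less_divide_iff zero_less_mult_iff divide_less_eq)
  then have "0 < j $ l" "j $ l < int N" unfolding of_int_0_less_iff of_int_less_iff .
  then show ?case by simp
next
  case (Suc m)
  let ?f = "(forward_diff ((2 * a / real N) *\<^sub>R axis i 1) ^^ m) \<rho>"
  have "?f (lattice_point N a (j + axis i 1)) \<noteq> 0 \<or> ?f (lattice_point N a j) \<noteq> 0"
    using Suc.prems unfolding forward_diff_Suc lattice_point_shift by auto
  then have "(j + axis i 1) $ l \<in> {- int m..<int N} \<or> j $ l \<in> {- int m..<int N}"
    using Suc.IH by blast
  then show ?case by (auto simp: axis_def split: if_splits)
qed

lemma zero_pad_density: "\<rho> \<in> densities L \<Longrightarrow> zero_pad L \<rho> = \<rho>"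
  using densities_outside[of \<rho> L] by (auto simp: zero_pad_def fun_eq_iff)

lemma fourier_coeff_lattice_transform:
  fixes q :: "int ^ 'n"
  assumes "\<rho> \<in> densities L" "L < a" "0 < L" "N > 0"
  shows "fourier_coeff N a \<rho> q = lattice_transform N a q \<rho> / of_nat N ^ CARD('n)"
proof -
  let ?F = "\<lambda>j. of_real (\<rho> (lattice_point N a j)) * cnj (fourier_mode a q (lattice_point N a j))"
  let ?box = "{j :: int ^ 'n. \<forall>i. j $ i \<in> {0..<int N}}"
  have "lattice_transform N a q \<rho> = (\<Sum>\<^sub>\<infinity>j\<in>?box. ?F j)"
    unfolding lattice_transform_def
    by (rule infsum_cong_neutral) (use densities_lattice_support[OF assms, where m = 0] in auto)
  also have "\<dots> = (\<Sum>j\<in>?box. ?F j)"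
    by (rule infsum_finite, rule finite_vec_box) simp
  also have "\<dots> = (\<Sum>j\<in>grid_indices N. of_real (\<rho> (grid_point N a j)) * cnj (fourier_mode a q (grid_point N a j)))"
    by (rule sum.reindex_bij_witness[of _ "\<lambda>j. \<chi> i. int (j $ i)" "\<lambda>j. \<chi> i. nat (j $ i)"])
      (auto simp: grid_indices_def grid_point_def lattice_point_def vec_eq_iff nat_less_iff)
  finally show ?thesis by (simp add: fourier_coeff_def)
qed

text \<open>The two inequalities on \<open>q $ i\<close> place the phase
  \<open>2 * pi * q $ i / N\<close> between \<open>pi / 2\<close> and \<open>pi\<close> in absolute
  value. There \<open>m\<close> summations by parts cost nothing, and the \<open>m\<close>-fold
  difference has size of order \<open>N ^ - m\<close>.\<close>

lemma fourier_coeff_decay_direction: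
  fixes i :: "'n :: finite"
  assumes "\<rho> \<in> densities L" "L < a" "0 < L"
  obtains C where "0 \<le> C" "\<And>N q. \<lbrakk>N > 0; int N \<le> 4 * \<bar>q $ i\<bar>; 2 * \<bar>q $ i\<bar> \<le> int N\<rbrakk> \<Longrightarrow>
     norm (fourier_coeff N a \<rho> q) \<le> C / real N ^ m"
proof -
  obtain B where B: "0 \<le> B" "\<And>x. \<bar>(dir_deriv (axis i 1) ^^ m) \<rho> x\<bar> \<le> B"
    using densities_dir_deriv_bounded[OF assms(1)] by blast
  define d where "d = CARD('n)"
  \<comment> \<open>\<open>(m + 1) ^ d\<close> comes from the at most
    \<open>(N + m) ^ d <= ((m + 1) * N) ^ d\<close> contributing lattice points,
    \<open>(2 * a) ^ m\<close> from the step \<open>2 * a / N\<close>, and \<open>B\<close> bounds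
    the derivative.\<close>
  define C where "C = real (m + 1) ^ d * (2 * a) ^ m * B"
  have "norm (fourier_coeff N a \<rho> q) \<le> C / real N ^ m"
    if N: "N > 0" and q: "int N \<le> 4 * \<bar>q $ i\<bar>" "2 * \<bar>q $ i\<bar> \<le> int N" for N q
  proof -
    let ?D = "(forward_diff ((2 * a / real N) *\<^sub>R axis i 1) ^^ m) \<rho>"
    let ?F = "\<lambda>j. of_real (?D (lattice_point N a j)) * cnj (fourier_mode a q (lattice_point N a j))"
    let ?w = "cis (2 * pi * of_int (q $ i) / real N)"
    let ?box = "{j :: int ^ 'n. \<forall>i. j $ i \<in> {- int m..<int N}}"
    have finbox: "finite ?box" by (rule finite_vec_box) simp
    have box: "j \<in> ?box" if "?D (lattice_point N a j) \<noteq> 0" for j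
      using densities_lattice_support[OF assms N that] by blast
    have "finite_lattice_support N a \<rho>"
      unfolding finite_lattice_support_def
      by (rule finite_subset[OF _ finite_vec_box[of "\<lambda>_. {- int 0..<int N}"]])
        (use densities_lattice_support[OF assms N, where m = 0] in auto)
    then have eq: "lattice_transform N a q ?D = (?w - 1) ^ m * lattice_transform N a q \<rho>"
      using lattice_transform_forward_diff_iterate[OF less_trans[OF assms(3,2)] N] by blast
    have "lattice_transform N a q ?D = (\<Sum>\<^sub>\<infinity>j\<in>?box. ?F j)"
      unfolding lattice_transform_def by (rule infsum_cong_neutral) (use box in auto)
    also have "\<dots> = (\<Sum>j\<in>?box. ?F j)" by (rule infsum_finite[OF finbox])
    finally have "norm (lattice_transform N a q ?D) = norm (\<Sum>j\<in>?box. ?F j)" by simp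
    also have "\<dots> \<le> (\<Sum>j\<in>?box. (2 * a / real N) ^ m * B)"
    proof (rule sum_norm_le)
      fix j
      show "norm (?F j) \<le> (2 * a / real N) ^ m * B"
        using forward_diff_iterate_bound[OF densities_smooth[OF assms(1)] _ B(2), of "2 * a / real N"] assms
        by (simp add: norm_mult)
    qed
    also have "\<dots> = real ((N + m) ^ d) * ((2 * a / real N) ^ m * B)"
      by (subst sum_constant, subst card_vec_box) (auto simp: d_def)
    also have "\<dots> \<le> real (((m + 1) * N) ^ d) * ((2 * a / real N) ^ m * B)"
    proof (rule mult_right_mono)
      have "m \<le> m * N" using N by simp
      then have "N + m \<le> (m + 1) * N" by simp
      then show "real ((N + m) ^ d) \<le> real (((m + 1) * N) ^ d)"
        by (intro of_nat_mono power_mono) auto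
    qed (use assms B in auto)
    finally have upper: "norm (lattice_transform N a q ?D) \<le> real (((m + 1) * N) ^ d) * ((2 * a / real N) ^ m * B)" .
    have "1 \<le> norm (?w - 1)"
    proof (rule norm_cis_minus_one_ge)
      have "real N \<le> 4 * \<bar>of_int (q $ i)\<bar>" "2 * \<bar>of_int (q $ i)\<bar> \<le> real N"
        using q by linarith+
      then show "pi / 2 \<le> \<bar>2 * pi * of_int (q $ i) / real N\<bar>" "\<bar>2 * pi * of_int (q $ i) / real N\<bar> \<le> pi"
        using N by (auto simp: abs_mult field_simps)
    qed
    then have "1 * norm (lattice_transform N a q \<rho>) \<le> norm ((?w - 1) ^ m) * norm (lattice_transform N a q \<rho>)"
      by (intro mult_right_mono) (auto simp: norm_power one_le_power)
    also have "\<dots> = norm (lattice_transform N a q ?D)" by (simp add: eq norm_mult)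
    also note upper
    finally have "norm (lattice_transform N a q \<rho>) / real N ^ d
      \<le> real (((m + 1) * N) ^ d) * ((2 * a / real N) ^ m * B) / real N ^ d"
      by (intro divide_right_mono) auto
    also have "\<dots> = C / real N ^ m"
      using N unfolding C_def of_nat_power of_nat_mult power_mult_distrib power_divide by simp
    finally show ?thesis
      using fourier_coeff_lattice_transform[OF assms N, of q] by (simp add: d_def norm_divide norm_power)
  qed
  moreover have "0 \<le> C" using assms B by (simp add: C_def)
  ultimately show thesis using that by blast
qed

text \<open>A frequency outside \<open>frequencies N\<close> has a coordinate with
  \<open>N <= 2 * \<bar>q $ i\<bar>\<close>, which is the lower bound of the directional estimate
  for the grid number \<open>2 * N\<close>. Since \<open>i\<close> depends on \<open>q\<close>, the
  constants are summed over all directions.\<close>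

lemma fourier_coeff_decay:
  assumes "\<rho> \<in> densities L" "L < a" "0 < L"
  obtains C where "0 \<le> C"
    "\<And>N q. \<lbrakk>N > 0; q \<in> frequencies (2 * N); q \<notin> frequencies N\<rbrakk> \<Longrightarrow>
     norm (fourier_coeff (2 * N) a \<rho> (q :: int ^ 'n)) \<le> C / real (2 * N) ^ m"
proof -
  have "\<exists>C. 0 \<le> C \<and> (\<forall>N q. N > 0 \<longrightarrow> int N \<le> 4 * \<bar>q $ i\<bar> \<longrightarrow> 2 * \<bar>q $ i\<bar> \<le> int N \<longrightarrow>
     norm (fourier_coeff N a \<rho> q) \<le> C / real N ^ m)" for i :: 'n
    using fourier_coeff_decay_direction[OF assms, of i m] by metis
  then obtain C :: "'n \<Rightarrow> real" where C: "\<And>i. 0 \<le> C i"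
    "\<And>i N q. \<lbrakk>N > 0; int N \<le> 4 * \<bar>q $ i\<bar>; 2 * \<bar>q $ i\<bar> \<le> int N\<rbrakk> \<Longrightarrow>
      norm (fourier_coeff N a \<rho> q) \<le> C i / real N ^ m" by metis
  have "norm (fourier_coeff (2 * N) a \<rho> q) \<le> (\<Sum>i\<in>UNIV. C i) / real (2 * N) ^ m"
    if N: "N > 0" and q: "q \<in> frequencies (2 * N)" "q \<notin> frequencies N" for N and q :: "int ^ 'n"
  proof -
    obtain i where i: "\<not> (- int N \<le> 2 * q $ i \<and> 2 * q $ i < int N)"
      using q(2) by (auto simp: frequencies_def)
    have "- int (2 * N) \<le> 2 * q $ i" "2 * q $ i < int (2 * N)"
      using q(1) by (auto simp: frequencies_def)
    then have "norm (fourier_coeff (2 * N) a \<rho> q) \<le> C i / real (2 * N) ^ m"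
      using i N by (intro C(2)) linarith+
    also have "\<dots> \<le> (\<Sum>i\<in>UNIV. C i) / real (2 * N) ^ m"
      by (intro divide_right_mono member_le_sum) (auto simp: C)
    finally show ?thesis .
  qed
  moreover have "0 \<le> (\<Sum>i\<in>UNIV. C i)" by (simp add: C sum_nonneg)
  ultimately show thesis using that by blast
qed

section \<open>Spectral accuracy\<close>

lemma finite_fourier_continuous:
  fixes x :: "real ^ 'n"
  shows "isCont (finite_fourier N a f) x"
proof -
  have cis: "isCont cis t" for t
    using continuous_on_cis[OF continuous_on_id, of UNIV] by (simp add: continuous_on_eq_continuous_at)
  have "isCont (fourier_mode a k) x" for k :: "int ^ 'n"
    unfolding fourier_mode_def
    by (rule isCont_o2[OF _ cis], rule continuous_mult[OF continuous_const]) (auto intro!: continuous_intros)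
  then show ?thesis unfolding finite_fourier_def by (auto intro!: continuous_intros)
qed

lemma fourier_mode_periodic:
  fixes k l :: "int ^ 'n"
  assumes "a \<noteq> 0"
  shows "fourier_mode a k (x + (2 * a) *\<^sub>R (\<chi> i. of_int (l $ i))) = fourier_mode a k x"
proof -
  have "pi / a * (\<Sum>i\<in>UNIV. of_int (k $ i) * ((2 * a) *\<^sub>R (\<chi> i. of_int (l $ i)) :: real ^ 'n) $ i)
     = 2 * pi * of_int (\<Sum>i\<in>UNIV. k $ i * l $ i)"
    using assms by (simp add: sum_distrib_left mult_ac)
  then have "fourier_mode a k ((2 * a) *\<^sub>R (\<chi> i. of_int (l $ i))) = 1"
    unfolding fourier_mode_def by (simp only: cis_multiple_2pi Ints_of_int)
  then show ?thesis by (simp add: fourier_mode_add)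
qed

lemma finite_fourier_periodic:
  fixes l :: "int ^ 'n"
  assumes "a \<noteq> 0"
  shows "finite_fourier N a f (x + (2 * a) *\<^sub>R (\<chi> i. of_int (l $ i))) = finite_fourier N a f x"
  using assms by (simp add: finite_fourier_def fourier_mode_periodic)

lemma grid_point_near:
  fixes x :: "real ^ 'n"
  assumes "a > 0" "M > 0" "x \<in> cube a"
  obtains j where "j \<in> grid_indices M" "dist x (grid_point M a j) \<le> real CARD('n) * (2 * a / real M)"
proof -
  define t where "t i = (x $ i + a) * real M / (2 * a)" for i
  have x: "- a \<le> x $ i" "x $ i \<le> a" for i
    using assms(3) by (auto simp: mem_cube abs_le_iff minus_le_iff)
  have t: "0 \<le> t i" "t i \<le> real M" for i
  proof -
    have "0 \<le> x $ i + a" using x(1)[of i] by linarith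
    then show "0 \<le> t i" using assms(1) by (simp add: t_def)
    have "(x $ i + a) * real M \<le> (2 * a) * real M"
      using x(2)[of i] by (intro mult_right_mono) auto
    then show "t i \<le> real M" using assms(1) by (simp add: t_def divide_le_eq mult_ac)
  qed
  have "\<exists>j::nat. j < M \<and> \<bar>t i - real j\<bar> \<le> 1" for i
  proof (cases "t i < real M")
    case True
    have "0 \<le> \<lfloor>t i\<rfloor>" "\<lfloor>t i\<rfloor> < int M"
      using t[of i] True by (simp_all add: floor_less_iff)
    moreover have "\<bar>t i - of_int \<lfloor>t i\<rfloor>\<bar> \<le> 1" by linarith
    ultimately show ?thesis by (intro exI[of _ "nat \<lfloor>t i\<rfloor>"]) (auto simp: nat_less_iff)
  next
    case False
    \<comment> \<open>The grid omits the right face; the last index is exactly one step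
      away.\<close>
    then have "t i = real M" using t[of i] by simp
    then show ?thesis using assms(2) by (intro exI[of _ "M - 1"]) (auto simp: of_nat_diff)
  qed
  then obtain j where j: "\<And>i. j i < M \<and> \<bar>t i - real (j i)\<bar> \<le> 1" by metis
  have "\<bar>(x - grid_point M a (\<chi> i. j i)) $ i\<bar> \<le> 2 * a / real M" for i
  proof -
    have "(x - grid_point M a (\<chi> i. j i)) $ i = (2 * a / real M) * (t i - real (j i))"
      using assms(1,2) by (simp add: grid_point_def t_def field_simps)
    moreover have "(2 * a / real M) * \<bar>t i - real (j i)\<bar> \<le> (2 * a / real M) * 1"
      using j[of i] assms by (intro mult_left_mono) auto
    ultimately show ?thesis using assms(1,2) by (simp add: abs_mult)
  qed
  then have "(\<Sum>i\<in>UNIV. \<bar>(x - grid_point M a (\<chi> i. j i)) $ i\<bar>) \<le> (\<Sum>i\<in>(UNIV :: 'n set). 2 * a / real M)"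
    by (rule sum_mono)
  then have "dist x (grid_point M a (\<chi> i. j i)) \<le> real CARD('n) * (2 * a / real M)"
    using norm_le_l1_cart[of "x - grid_point M a (\<chi> i. j i)"] by (simp add: dist_norm)
  then show thesis using that[of "\<chi> i. j i"] j by (simp add: grid_indices_def)
qed

text \<open>Comparing the grids \<open>N, 2N, 4N, \<dots>\<close> bounds the interpolation error without reference to the
  Fourier series of \<open>\<rho>\<close>: on the finest of these grids the interpolant is exact at a grid point
  close to \<open>x\<close>.\<close>

lemma finite_fourier_error:
  fixes \<rho> :: "real ^ 'n \<Rightarrow> real"
  assumes "\<rho> \<in> densities L" "L < a" "0 < L"
  shows "\<exists>C\<ge>0. \<forall>N>0. \<forall>x\<in>cube a. norm (finite_fourier N a \<rho> x - of_real (\<rho> x)) \<le> C / real N ^ m"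
proof -
  define d where "d = CARD('n)"
  have "a > 0" using assms by simp
  \<comment> \<open>In the exponent, \<open>d\<close> powers pay for the number of modes and one
    more power makes the doubling errors a convergent geometric series.\<close>
  obtain C where C: "0 \<le> C"
    "\<And>N q. \<lbrakk>N > 0; q \<in> frequencies (2 * N); q \<notin> frequencies N\<rbrakk> \<Longrightarrow>
     norm (fourier_coeff (2 * N) a \<rho> (q :: int ^ 'n)) \<le> C / real (2 * N) ^ (m + 1 + d)"
    using fourier_coeff_decay[OF assms, of "m + 1 + d"] by metis
  have step: "norm (finite_fourier (2 * N) a \<rho> x - finite_fourier N a \<rho> x) \<le> 2 * C / real (2 * N) ^ (m + 1)"
    if N: "N > 0" for N and x :: "real ^ 'n"
  proof -
    have "norm (finite_fourier (2 * N) a \<rho> x - finite_fourier N a \<rho> x)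
       \<le> 2 * (C / real (2 * N) ^ (m + 1 + d)) * real (2 * N) ^ d"
      unfolding d_def
      by (rule finite_fourier_doubling[OF \<open>a > 0\<close> N C(2)[OF N, unfolded d_def]]) (use C(1) in auto)
    then show ?thesis using N by (simp only: power_add) (simp add: field_simps)
  qed
  \<comment> \<open>The factor \<open>1 - 1 / 2 ^ i\<close> is the partial sum of that series, kept
    so that the induction closes.\<close>
  have tail: "norm (finite_fourier (2 ^ i * N) a \<rho> x - finite_fourier N a \<rho> x)
      \<le> 2 * C / real N ^ m * (1 - 1 / 2 ^ i)"
    if N: "N > 0" for i N and x :: "real ^ 'n"
  proof (induction i)
    case (Suc i)
    have "norm (finite_fourier (2 * (2 ^ i * N)) a \<rho> x - finite_fourier (2 ^ i * N) a \<rho> x)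
        \<le> 2 * C / real (2 * (2 ^ i * N)) ^ (m + 1)"
      by (rule step) (use N in simp)
    also have "\<dots> \<le> 2 * C / (real N ^ m * 2 ^ Suc i)"
    proof (rule divide_left_mono)
      have "N * 1 \<le> N * (2 * 2 ^ i)" by (intro mult_left_mono) auto
      then have "real N \<le> real (2 * (2 ^ i * N))" by (simp only: of_nat_le_iff) (simp add: mult_ac)
      moreover have "(2 :: real) ^ Suc i \<le> real (2 * (2 ^ i * N))" using N by simp
      ultimately have "real N ^ m * 2 ^ Suc i \<le> real (2 * (2 ^ i * N)) ^ m * real (2 * (2 ^ i * N))"
        by (intro mult_mono power_mono) auto
      then show "real N ^ m * 2 ^ Suc i \<le> real (2 * (2 ^ i * N)) ^ (m + 1)" by (simp add: mult.commute)
    qed (use C(1) N in auto)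
    also have "\<dots> = 2 * C / real N ^ m * (1 / 2 ^ Suc i)" by simp
    finally have *: "norm (finite_fourier (2 ^ Suc i * N) a \<rho> x - finite_fourier (2 ^ i * N) a \<rho> x)
       \<le> 2 * C / real N ^ m * (1 / 2 ^ Suc i)" by (simp add: mult.assoc)
    have "norm (finite_fourier (2 ^ Suc i * N) a \<rho> x - finite_fourier N a \<rho> x)
       \<le> 2 * C / real N ^ m * (1 / 2 ^ Suc i) + 2 * C / real N ^ m * (1 - 1 / 2 ^ i)"
      using add_mono[OF * Suc.IH] norm_triangle_ineq[of
        "finite_fourier (2 ^ Suc i * N) a \<rho> x - finite_fourier (2 ^ i * N) a \<rho> x"
        "finite_fourier (2 ^ i * N) a \<rho> x - finite_fourier N a \<rho> x"]
      unfolding diff_add_cancel add_diff_eq by linarith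
    also have "\<dots> = 2 * C / real N ^ m * (1 - 1 / 2 ^ Suc i)"
      unfolding distrib_left[symmetric] by simp
    finally show ?case .
  qed simp
  have "norm (finite_fourier N a \<rho> x - of_real (\<rho> x)) \<le> 2 * C / real N ^ m"
    if N: "N > 0" and x: "x \<in> cube a" for N and x :: "real ^ 'n"
  proof (rule field_le_epsilon)
    fix e :: real
    assume "e > 0"
    have "isCont \<rho> x"
      using smooth_continuous_on[OF densities_smooth[OF assms(1)], of UNIV]
      by (simp add: continuous_on_eq_continuous_at)
    then obtain d1 where d1: "d1 > 0" "\<And>y. dist y x < d1 \<Longrightarrow> dist (\<rho> y) (\<rho> x) < e / 2"
      using \<open>e > 0\<close> unfolding continuous_at_eps_delta by (metis half_gt_zero)
    \<comment> \<open>The interpolant here is the one for the fixed \<open>N\<close>, so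
      \<open>d2\<close> does not depend on the refinement level \<open>i\<close> chosen
      below.\<close>
    obtain d2 where d2: "d2 > 0"
      "\<And>y. dist y x < d2 \<Longrightarrow> dist (finite_fourier N a \<rho> y) (finite_fourier N a \<rho> x) < e / 2"
      using \<open>e > 0\<close> finite_fourier_continuous[of x N a \<rho>] unfolding continuous_at_eps_delta
      by (metis half_gt_zero)
    define r where "r = real CARD('n) * (2 * a)"
    obtain i :: nat where "r / min d1 d2 < 2 ^ i" using real_arch_pow[of 2] by auto
    moreover have "0 < min d1 d2" using d1(1) d2(1) by simp
    ultimately have i: "r / 2 ^ i < min d1 d2" by (simp only: pos_divide_less_eq zero_less_power zero_less_numeral mult.commute)
    obtain j where j: "j \<in> grid_indices (2 ^ i * N)"
      and "dist x (grid_point (2 ^ i * N) a j) \<le> real CARD('n) * (2 * a / real (2 ^ i * N))"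
      using grid_point_near[OF \<open>a > 0\<close> _ x, of "2 ^ i * N"] N by auto
    moreover have "real CARD('n) * (2 * a / real (2 ^ i * N)) \<le> r / 2 ^ i"
    proof -
      have "r / (2 ^ i * real N) \<le> r / (2 ^ i * 1)"
        using N \<open>a > 0\<close> by (intro divide_left_mono mult_left_mono) (auto simp: r_def)
      then show ?thesis by (simp add: r_def)
    qed
    ultimately have near: "dist (grid_point (2 ^ i * N) a j) x < min d1 d2"
      using i by (simp add: dist_commute)
    let ?g = "grid_point (2 ^ i * N) a j"
    have "finite_fourier (2 ^ i * N) a \<rho> ?g = of_real (\<rho> ?g)"
      by (rule finite_fourier_grid_point[OF \<open>a > 0\<close> _ j]) (use N in simp)
    moreover have "norm (finite_fourier (2 ^ i * N) a \<rho> ?g - finite_fourier N a \<rho> ?g) \<le> 2 * C / real N ^ m"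
      by (rule order_trans[OF tail[OF N] mult_left_le]) (use C(1) in auto)
    ultimately have "norm (finite_fourier N a \<rho> ?g - of_real (\<rho> ?g)) \<le> 2 * C / real N ^ m"
      by (simp add: norm_minus_commute)
    moreover have "norm (finite_fourier N a \<rho> ?g - finite_fourier N a \<rho> x) < e / 2"
      using d2(2)[of ?g] near by (simp add: dist_norm)
    moreover have "norm (of_real (\<rho> ?g) - of_real (\<rho> x) :: complex) < e / 2"
      using d1(2)[of ?g] near by (simp add: dist_norm flip: of_real_diff)
    moreover have "finite_fourier N a \<rho> x - of_real (\<rho> x) = (finite_fourier N a \<rho> ?g - of_real (\<rho> ?g))
       + (of_real (\<rho> ?g) - of_real (\<rho> x)) - (finite_fourier N a \<rho> ?g - finite_fourier N a \<rho> x)" by simp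
    ultimately show "norm (finite_fourier N a \<rho> x - of_real (\<rho> x)) \<le> 2 * C / real N ^ m + e"
      by (smt (verit) norm_triangle_ineq norm_triangle_ineq4 field_sum_of_halves)
  qed
  then show ?thesis using C(1) by (intro exI[of _ "2 * C"]) auto
qed

section \<open>Periodic extension of the interpolants\<close>

lemma cube_representative:
  fixes x :: "real ^ 'n"
  assumes "a > 0"
  obtains l :: "int ^ 'n" where "x - (2 * a) *\<^sub>R (\<chi> i. of_int (l $ i)) \<in> cube a"
proof -
  define l :: "int ^ 'n" where "l = (\<chi> i. \<lfloor>(x $ i + a) / (2 * a)\<rfloor>)"
  have "\<bar>(x - (2 * a) *\<^sub>R (\<chi> i. of_int (l $ i))) $ i\<bar> \<le> a" for i
  proof -
    have "of_int (l $ i) \<le> (x $ i + a) / (2 * a)" "(x $ i + a) / (2 * a) < of_int (l $ i) + 1"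
      by (auto simp: l_def)
    then have "2 * a * of_int (l $ i) \<le> x $ i + a" "x $ i + a < 2 * a * of_int (l $ i) + 2 * a"
      using assms by (auto simp: field_simps)
    then show ?thesis by (simp add: abs_le_iff)
  qed
  then show thesis using that[of l] by (simp add: mem_cube)
qed

lemma padded_fourier_eq:
  "\<rho> \<in> densities L \<Longrightarrow> padded_fourier S L \<rho> N = finite_fourier N (S * L) \<rho>"
  by (simp add: padded_fourier_def zero_pad_density)

lemma padded_fourier_spectral:
  fixes \<rho> :: "real ^ 'n \<Rightarrow> real"
  assumes "\<rho> \<in> densities L" "1 < S" "0 < L"
  shows "spectral_approx (cube ((2 * S - 1) * L)) (padded_fourier S L \<rho>) \<rho>"
  unfolding spectral_approx_def
proof
  fix m
  define a where "a = S * L"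
  have a: "L < a" "a > 0" using assms by (auto simp: a_def)
  obtain C where C: "\<And>N x. N > 0 \<Longrightarrow> x \<in> cube a \<Longrightarrow>
      norm (finite_fourier N a \<rho> x - of_real (\<rho> x)) \<le> C / real N ^ m"
    using finite_fourier_error[OF assms(1) a(1) assms(3)] by blast
  have "norm (finite_fourier N a \<rho> x - of_real (\<rho> x)) \<le> C / real N ^ m"
    if N: "N > 0" and x: "x \<in> cube ((2 * S - 1) * L)" for N and x :: "real ^ 'n"
  proof -
    obtain l :: "int ^ 'n" where l: "x - (2 * a) *\<^sub>R (\<chi> i. of_int (l $ i)) \<in> cube a"
      using cube_representative[OF a(2)] by blast
    define y where "y = x - (2 * a) *\<^sub>R (\<chi> i. of_int (l $ i))"
    have xy: "x = y + (2 * a) *\<^sub>R (\<chi> i. of_int (l $ i))" by (simp add: y_def)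
    have "finite_fourier N a \<rho> x = finite_fourier N a \<rho> y"
      unfolding xy by (rule finite_fourier_periodic) (use a in simp)
    moreover have "\<rho> x = \<rho> y"
    proof (cases "\<exists>i. l $ i \<noteq> 0")
      case True
      then obtain i where i: "l $ i \<noteq> 0" by blast
      have "\<bar>y $ i\<bar> \<le> a" using l by (simp add: mem_cube y_def)
      moreover have "\<bar>x $ i\<bar> \<le> 2 * a - L" using x by (simp add: mem_cube a_def algebra_simps)
      \<comment> \<open>A nonzero shift separates the coordinates by at least \<open>2 * a\<close>.
        As one has size at most \<open>2 * a - L\<close> and the other at most \<open>a\<close>,
        both have size at least \<open>L\<close>, where the density vanishes.\<close>
      moreover have "2 * a * 1 \<le> 2 * a * \<bar>of_int (l $ i)\<bar>"
        using i a by (intro mult_left_mono) auto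
      moreover have "\<bar>x $ i - y $ i\<bar> = 2 * a * \<bar>of_int (l $ i)\<bar>"
        using a by (simp add: y_def abs_mult)
      ultimately have "L \<le> \<bar>x $ i\<bar>" "L \<le> \<bar>y $ i\<bar>" using a by linarith+
      then show ?thesis using densities_outside_interior[OF assms(1)] by metis
    next
      case False
      then have "(\<chi> i. of_int (l $ i)) = (0 :: real ^ 'n)" by (simp add: vec_eq_iff)
      then show ?thesis by (simp add: y_def)
    qed
    ultimately show ?thesis using C[OF N, of y] l by (simp add: y_def)
  qed
  then show "\<exists>C. \<forall>N>0. \<forall>x\<in>cube ((2 * S - 1) * L). norm (padded_fourier S L \<rho> N x - of_real (\<rho> x)) \<le> C / real N ^ m"
    unfolding padded_fourier_eq[OF assms(1)] a_def by blast
qed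

lemma spectral_approx_subset: "A \<subseteq> B \<Longrightarrow> spectral_approx B f g \<Longrightarrow> spectral_approx A f g"
  unfolding spectral_approx_def by blast

lemma cube_mono: "a \<le> b \<Longrightarrow> cube a \<subseteq> cube b"
  unfolding mem_cube subset_iff by (meson order_trans)

lemma adequate_padding_sufficient:
  assumes "0 < L" "1 < S" "sqrt (real CARD('n::finite)) + 1 \<le> S"
  shows "adequate_padding TYPE('n) L S"
  unfolding adequate_padding_def
proof
  fix \<rho> :: "real ^ 'n \<Rightarrow> real"
  assume "\<rho> \<in> densities L"
  moreover have "(2 * sqrt (real CARD('n)) + 1) * L \<le> (2 * S - 1) * L"
    using assms by (intro mult_right_mono) auto
  ultimately show "spectral_approx (cube ((2 * sqrt (real CARD('n)) + 1) * L)) (padded_fourier S L \<rho>) \<rho>"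
    using assms spectral_approx_subset[OF cube_mono padded_fourier_spectral] by blast
qed

section \<open>Smooth bump functions\<close>

text \<open>The powers of \<open>inverse t\<close> are included because the derivatives of
  \<open>exp (- inverse t)\<close> are combinations of such functions.\<close>

definition exp_inverse :: "nat \<Rightarrow> real \<Rightarrow> real" where
  "exp_inverse n t = (if 0 < t then exp (- inverse t) * inverse t ^ n else 0)"

lemma exp_inverse_tendsto_0: "(exp_inverse n \<longlongrightarrow> 0) (at 0)"
proof (rule filterlim_split_at)
  have "\<forall>\<^sub>F t in at_left 0. exp_inverse n t = 0"
    by (simp add: eventually_at_filter exp_inverse_def)
  then show "(exp_inverse n \<longlongrightarrow> 0) (at_left 0)" by (rule tendsto_eventually)
  have "((\<lambda>t. inverse t ^ n / exp (inverse t)) \<longlongrightarrow> (0::real)) (at_right 0)"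
    by (rule filterlim_compose[OF tendsto_power_div_exp_0 filterlim_inverse_at_top_right])
  moreover have "\<forall>\<^sub>F t in at_right 0. inverse t ^ n / exp (inverse t) = exp_inverse n t"
    by (simp add: eventually_at_filter exp_inverse_def exp_minus divide_inverse mult.commute)
  ultimately show "(exp_inverse n \<longlongrightarrow> 0) (at_right 0)" by (rule Lim_transform_eventually)
qed

lemma exp_inverse_derivative:
  "(exp_inverse n has_real_derivative exp_inverse (n + 2) t - real n * exp_inverse (n + 1) t) (at t)"
proof -
  consider "t < 0" | "t = 0" | "0 < t" by linarith
  then show ?thesis
  proof cases
    case 1
    have "((\<lambda>_. 0) has_real_derivative 0) (at t)" by simp
    then have "(exp_inverse n has_real_derivative 0) (at t)"
      by (rule has_field_derivative_transform_within_open[where S = "{..<0}"])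
        (use 1 in \<open>auto simp: exp_inverse_def\<close>)
    then show ?thesis using 1 by (simp add: exp_inverse_def)
  next
    case 2
    \<comment> \<open>At 0 the difference quotient is itself the next member of the family, so the
      limit lemma gives the derivative.\<close>
    have eq: "(exp_inverse n (0 + h) - exp_inverse n 0) / h = exp_inverse (n + 1) h" for h
      by (simp add: exp_inverse_def divide_inverse mult_ac)
    have "(exp_inverse n has_real_derivative 0) (at 0)"
      unfolding DERIV_def eq by (rule exp_inverse_tendsto_0)
    then show ?thesis using 2 by (simp add: exp_inverse_def)
  next
    case 3
    have inv: "(inverse has_real_derivative - (inverse t ^ Suc (Suc 0))) (at t)"
      using 3 by (intro DERIV_inverse) simp
    have "exp (- inverse t) * - (- (inverse t ^ Suc (Suc 0))) * inverse t ^ n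
        + real n * (- (inverse t ^ Suc (Suc 0)) * inverse t ^ (n - Suc 0)) * exp (- inverse t)
      = exp_inverse (n + 2) t - real n * exp_inverse (n + 1) t"
      using 3 by (cases n) (simp_all add: exp_inverse_def)
    then have "((\<lambda>t. exp (- inverse t) * inverse t ^ n) has_real_derivative
        exp_inverse (n + 2) t - real n * exp_inverse (n + 1) t) (at t)"
      using DERIV_mult[OF DERIV_chain2[OF DERIV_exp DERIV_minus[OF inv]] DERIV_power[OF inv, of n]]
      by simp
    then show ?thesis
      by (rule has_field_derivative_transform_within_open[where S = "{0<..}"])
        (use 3 in \<open>auto simp: exp_inverse_def\<close>)
  qed
qed

text \<open>A class of functions that contains the bump functions and is closed under directional
  derivatives.\<close>

inductive bump_algebra :: "real ^ 'n \<Rightarrow> real \<Rightarrow> (real ^ 'n \<Rightarrow> real) \<Rightarrow> bool" for z r where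
  const: "bump_algebra z r (\<lambda>_. c)"
| linear: "bump_algebra z r (\<lambda>x. (x - z) \<bullet> v)"
| bump: "bump_algebra z r (\<lambda>x. exp_inverse n (r\<^sup>2 - (x - z) \<bullet> (x - z)))"
| add: "bump_algebra z r f \<Longrightarrow> bump_algebra z r g \<Longrightarrow> bump_algebra z r (\<lambda>x. f x + g x)"
| mult: "bump_algebra z r f \<Longrightarrow> bump_algebra z r g \<Longrightarrow> bump_algebra z r (\<lambda>x. f x * g x)"

lemma bump_algebra_derivative:
  "bump_algebra z r f \<Longrightarrow> \<exists>f'. (\<forall>x. (f has_derivative f' x) (at x)) \<and> (\<forall>v. bump_algebra z r (\<lambda>x. f' x v))"
proof (induction rule: bump_algebra.induct)
  case (const c)
  show ?case by (rule exI[of _ "\<lambda>_ _. 0"]) (auto intro: bump_algebra.const)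
next
  case (linear v)
  show ?case
    by (rule exI[of _ "\<lambda>_ w. w \<bullet> v"]) (auto intro!: bump_algebra.const derivative_eq_intros)
next
  case (bump n)
  let ?s = "\<lambda>x. r\<^sup>2 - (x - z) \<bullet> (x - z)"
  let ?f' = "\<lambda>x v. (exp_inverse (n + 2) (?s x) + (- real n) * exp_inverse (n + 1) (?s x)) * ((- 2) * ((x - z) \<bullet> v))"
  have "((\<lambda>x. exp_inverse n (?s x)) has_derivative ?f' x) (at x)" for x
  proof -
    have s: "(?s has_derivative (\<lambda>v. - 2 * ((x - z) \<bullet> v))) (at x)"
      by (auto intro!: derivative_eq_intros simp: inner_commute)
    show ?thesis
      using has_derivative_compose[OF s exp_inverse_derivative[unfolded has_field_derivative_def]] by simp
  qed
  moreover have "bump_algebra z r (\<lambda>x. ?f' x v)" for v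
    by (intro bump_algebra.intros)
  ultimately show ?case by (intro exI[of _ ?f']) blast
next
  case (add f g)
  then obtain f' g' where
    "\<And>x. (f has_derivative f' x) (at x)" "\<And>v. bump_algebra z r (\<lambda>x. f' x v)"
    "\<And>x. (g has_derivative g' x) (at x)" "\<And>v. bump_algebra z r (\<lambda>x. g' x v)" by metis
  then show ?case
    by (intro exI[of _ "\<lambda>x v. f' x v + g' x v"]) (auto intro: bump_algebra.add has_derivative_add)
next
  case (mult f g)
  then obtain f' g' where
    f': "\<And>x. (f has_derivative f' x) (at x)" "\<And>v. bump_algebra z r (\<lambda>x. f' x v)" and
    g': "\<And>x. (g has_derivative g' x) (at x)" "\<And>v. bump_algebra z r (\<lambda>x. g' x v)" by metis
  show ?case
    using has_derivative_mult[OF f'(1) g'(1)]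
      bump_algebra.add[OF bump_algebra.mult[OF mult.hyps(1) g'(2)] bump_algebra.mult[OF f'(2) mult.hyps(2)]]
    by (intro exI[of _ "\<lambda>x v. f x * g' x v + f' x v * g x"]) blast
qed

lemma bump_algebra_cont_diff: "bump_algebra z r f \<Longrightarrow> cont_diff k f"
proof (induction k arbitrary: f)
  case 0
  obtain f' where "\<And>x. (f has_derivative f' x) (at x)" using bump_algebra_derivative[OF 0] by blast
  then show ?case by (auto intro!: continuous_at_imp_continuous_on has_derivative_continuous)
next
  case (Suc k)
  obtain f' where f': "\<And>x. (f has_derivative f' x) (at x)" "\<And>v. bump_algebra z r (\<lambda>x. f' x v)"
    using bump_algebra_derivative[OF Suc.prems] by blast
  have "frechet_derivative f (at x) = f' x" for x using frechet_derivative_at[OF f'(1)] by simp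
  then show ?case using Suc.IH[OF f'(2)] f'(1) by (auto simp: differentiable_def)
qed

text \<open>The argument uses the squared distance, a polynomial, so smoothness holds at the centre
  too; flatness of \<open>exp_inverse\<close> at 0 takes care of the sphere.\<close>

lemma bump_density:
  fixes z :: "real ^ 'n"
  assumes "0 < r" "\<And>i. \<bar>z $ i\<bar> + r \<le> L"
  obtains \<rho> where "\<rho> \<in> densities L" "\<And>x. 0 \<le> \<rho> x" "0 < \<rho> z" "\<And>x. r \<le> dist x z \<Longrightarrow> \<rho> x = 0"
proof -
  define \<rho> where "\<rho> x = exp_inverse 0 (r\<^sup>2 - (x - z) \<bullet> (x - z))" for x
  have zero: "\<rho> x = 0" if "r \<le> dist x z" for x
  proof -
    have "r\<^sup>2 \<le> (norm (x - z))\<^sup>2" using that assms(1) by (intro power_mono) (auto simp: dist_norm)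
    then show ?thesis by (simp add: \<rho>_def exp_inverse_def power2_norm_eq_inner)
  qed
  have "\<bar>x $ i\<bar> \<le> L" if "dist x z \<le> r" for x i
    using component_le_norm_cart[of "x - z" i] that assms(2)[of i] by (simp add: dist_norm)
  then have "cball z r \<subseteq> cube L" by (auto simp: mem_cube dist_commute)
  moreover have "closure {x. \<rho> x \<noteq> 0} \<subseteq> cball z r"
  proof (rule closure_minimal)
    show "{x. \<rho> x \<noteq> 0} \<subseteq> cball z r" using zero by (auto simp: dist_commute) (metis linorder_linear)
  qed simp
  moreover have "smooth \<rho>"
    unfolding smooth_def \<rho>_def using bump_algebra_cont_diff[OF bump_algebra.bump] by blast
  ultimately have "\<rho> \<in> densities L" by (auto simp: densities_def)
  moreover have "0 \<le> \<rho> x" for x by (simp add: \<rho>_def exp_inverse_def)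
  moreover have "0 < \<rho> z" using assms(1) by (simp add: \<rho>_def exp_inverse_def)
  ultimately show thesis using zero that by blast
qed

section \<open>The kernel truncation method\<close>

lemma truncation_region:
  assumes "0 < L"
  shows "(\<forall>x \<in> cube L :: (real ^ 'n) set. \<forall>y \<in> trunc_ball L. x - y \<in> cube a)
     \<longleftrightarrow> (2 * sqrt (real CARD('n)) + 1) * L \<le> a"
proof
  assume region: "\<forall>x \<in> cube L :: (real ^ 'n) set. \<forall>y \<in> trunc_ball L. x - y \<in> cube a"
  \<comment> \<open>The extreme case lies along a coordinate axis: a face centre minus the antipodal
    pole of the ball.\<close>
  define i :: 'n where "i = undefined"
  define e :: "real ^ 'n" where "e = axis i 1"
  have e: "e $ i = 1" "norm e = 1" by (simp_all add: e_def)
  have "L *\<^sub>R e \<in> cube L" using assms by (auto simp: mem_cube e_def axis_def)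
  moreover have "- (2 * sqrt (real CARD('n)) * L) *\<^sub>R e \<in> trunc_ball L"
    using assms by (simp add: trunc_ball_def e)
  ultimately have "L *\<^sub>R e - (- (2 * sqrt (real CARD('n)) * L) *\<^sub>R e) \<in> cube a" using region by blast
  then have "\<bar>L + 2 * sqrt (real CARD('n)) * L\<bar> \<le> a"
    unfolding mem_cube by (auto simp: e dest: spec[of _ i])
  then show "(2 * sqrt (real CARD('n)) + 1) * L \<le> a" by (simp add: algebra_simps)
next
  assume a: "(2 * sqrt (real CARD('n)) + 1) * L \<le> a"
  show "\<forall>x \<in> cube L :: (real ^ 'n) set. \<forall>y \<in> trunc_ball L. x - y \<in> cube a"
  proof (intro ballI)
    fix x y :: "real ^ 'n"
    assume x: "x \<in> cube L" and y: "y \<in> trunc_ball L"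
    have "\<bar>(x - y) $ i\<bar> \<le> a" for i
    proof -
      have "\<bar>x $ i\<bar> \<le> L" using x by (simp add: mem_cube)
      moreover have "\<bar>y $ i\<bar> \<le> 2 * sqrt (real CARD('n)) * L"
        using component_le_norm_cart[of y i] y by (simp add: trunc_ball_def)
      ultimately show ?thesis using a by (simp add: algebra_simps)
    qed
    then show "x - y \<in> cube a" by (simp add: mem_cube)
  qed
qed

text \<open>The radius is the diagonal of the cube: each of the d coordinates contributes at most
  \<open>(2 * L)\<^sup>2\<close>. Hence truncating the kernel does not change the potential on the
  cube.\<close>

lemma cube_diff_in_trunc_ball:
  fixes x y :: "real ^ 'n"
  assumes "0 < L" "x \<in> cube L" "y \<in> cube L"
  shows "x - y \<in> trunc_ball L"
proof -
  have "(norm (x - y))\<^sup>2 = (\<Sum>i\<in>UNIV. ((x - y) $ i)\<^sup>2)"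
    by (simp add: norm_vec_def L2_set_def sum_nonneg)
  also have "\<dots> \<le> (\<Sum>i\<in>(UNIV :: 'n set). (2 * L)\<^sup>2)"
  proof (rule sum_mono)
    fix i
    have "\<bar>x $ i\<bar> \<le> L" "\<bar>y $ i\<bar> \<le> L" using assms by (auto simp: mem_cube)
    then have "\<bar>(x - y) $ i\<bar> \<le> \<bar>2 * L\<bar>" by simp
    then show "((x - y) $ i)\<^sup>2 \<le> (2 * L)\<^sup>2" by (simp only: abs_le_square_iff)
  qed
  also have "\<dots> = (2 * sqrt (real CARD('n)) * L)\<^sup>2" by (simp add: power_mult_distrib)
  finally have "norm (x - y) \<le> 2 * sqrt (real CARD('n)) * L"
    by (rule power2_le_imp_le) (use assms(1) in simp)
  then show ?thesis by (simp add: trunc_ball_def)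
qed

lemma lborel_integral_reflect:
  fixes f :: "'a::euclidean_space \<Rightarrow> 'b::{banach, second_countable_topology}"
  assumes [measurable]: "f \<in> borel_measurable borel"
  shows "(LINT y|lborel. f (x - y)) = (LINT y|lborel. f y)"
proof -
  have "distr lborel borel (\<lambda>y. x + (- 1) *\<^sub>R y) = (lborel :: 'a measure)"
    by (subst (2) lborel_affine[of "- 1" x]) (auto simp: density_1)
  then have "(LINT y|lborel. f y) = (LINT y|distr lborel borel (\<lambda>y. x + (- 1) *\<^sub>R y). f y)" by simp
  also have "\<dots> = (LINT y|lborel. f (x - y))" by (subst integral_distr) auto
  finally show ?thesis by simp
qed

lemma densities_measurable:
  assumes "\<rho> \<in> densities L"
  shows "\<rho> \<in> borel_measurable borel"
  using smooth_continuous_on[OF densities_smooth[OF assms]] by (rule borel_measurable_continuous_onI)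

lemma potential_truncated:
  fixes U :: "real ^ 'n \<Rightarrow> real"
  assumes "0 < L" "set_integrable lborel (trunc_ball L) U" "\<rho> \<in> densities L" "x \<in> cube L"
  shows "potential U \<rho> x = (LINT y:trunc_ball L|lborel. U y * \<rho> (x - y))"
proof -
  let ?V = "\<lambda>y. indicator (trunc_ball L) y *\<^sub>R U y"
  have [measurable]: "?V \<in> borel_measurable borel"
    using borel_measurable_integrable[OF assms(2)[unfolded set_integrable_def]] by simp
  note [measurable] = densities_measurable[OF assms(3)]
  have "U (x - y) * \<rho> y = ?V (x - y) * \<rho> (x - (x - y))" for y
    using cube_diff_in_trunc_ball[OF assms(1,4), of y] densities_outside[OF assms(3), of y]
    by (cases "y \<in> cube L") auto
  then have "potential U \<rho> x = (LINT y|lborel. (\<lambda>w. ?V w * \<rho> (x - w)) (x - y))"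
    by (simp only: potential_def)
  also have "\<dots> = (LINT y|lborel. ?V y * \<rho> (x - y))" by (rule lborel_integral_reflect) measurable
  finally show ?thesis by (simp add: set_lebesgue_integral_def mult.assoc)
qed

lemma finite_fourier_bounded: "norm (finite_fourier N a f x) \<le> (\<Sum>k\<in>frequencies N. norm (fourier_coeff N a f k))"
  unfolding finite_fourier_def by (rule sum_norm_le) (simp add: norm_mult)

text \<open>Writes the potential error as the kernel integrated against the density error.
  Interpolant and density are bounded, so both integrands are dominated by a multiple of the
  truncated kernel and the integrals may be subtracted.\<close>

lemma ktm_error_integral:
  fixes U :: "real ^ 'n \<Rightarrow> real" and S :: real
  assumes "0 < L" "set_integrable lborel (trunc_ball L) U" "\<rho> \<in> densities L" "x \<in> cube L"
  defines "E \<equiv> \<lambda>N y. of_real (indicator (trunc_ball L) y * U y) * (padded_fourier S L \<rho> N (x - y) - of_real (\<rho> (x - y)))"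
  shows "integrable lborel (E N)"
    and "ktm_potential S L U \<rho> N x - of_real (potential U \<rho> x) = integral\<^sup>L lborel (E N)"
proof -
  let ?V = "\<lambda>y. indicator (trunc_ball L) y * U y"
  let ?F = "\<lambda>y. padded_fourier S L \<rho> N (x - y)"
  have V: "integrable lborel ?V" using assms(2) by (simp add: set_integrable_def)
  have bounded_mult: "integrable lborel (\<lambda>y. of_real (?V y) * g y)"
    if [measurable]: "g \<in> borel_measurable borel" and g: "\<And>y. norm (g y) \<le> K" for g :: "real ^ 'n \<Rightarrow> complex" and K
  proof (rule Bochner_Integration.integrable_bound[OF integrable_mult_right[OF V, of K]])
    have [measurable]: "?V \<in> borel_measurable borel" using borel_measurable_integrable[OF V] by simp
    show "(\<lambda>y. of_real (?V y) * g y) \<in> borel_measurable lborel" by measurable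
    have "0 \<le> K" using order_trans[OF norm_ge_zero g] .
    then have "norm (of_real (?V y) * g y) \<le> norm (K * ?V y)" for y
      using mult_left_mono[OF g[of y], of "\<bar>?V y\<bar>"] by (simp add: norm_mult abs_mult mult.commute)
    then show "AE y in lborel. norm (of_real (?V y) * g y) \<le> norm (K * ?V y)" by simp
  qed
  have "continuous_on UNIV (padded_fourier S L \<rho> N)"
    unfolding padded_fourier_def using finite_fourier_continuous by (blast intro: continuous_at_imp_continuous_on)
  then have [measurable]: "padded_fourier S L \<rho> N \<in> borel_measurable borel"
    by (rule borel_measurable_continuous_onI)
  note [measurable] = densities_measurable[OF assms(3)]
  have F: "integrable lborel (\<lambda>y. of_real (?V y) * ?F y)"
    by (rule bounded_mult) (measurable, unfold padded_fourier_def, rule finite_fourier_bounded)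
  obtain B where "\<And>y. \<bar>\<rho> y\<bar> \<le> B" using densities_dir_deriv_bounded[OF assms(3), of 0 0] by auto
  then have R: "integrable lborel (\<lambda>y. of_real (?V y) * (of_real (\<rho> (x - y)) :: complex))"
    by (intro bounded_mult[of _ B]) auto
  show "integrable lborel (E N)"
    unfolding E_def right_diff_distrib by (rule Bochner_Integration.integrable_diff[OF F R])
  have "of_real (potential U \<rho> x) = (LINT y|lborel. of_real (?V y) * (of_real (\<rho> (x - y)) :: complex))"
    unfolding potential_truncated[OF assms(1-4)] set_lebesgue_integral_def integral_complex_of_real[symmetric]
    by (simp add: mult.assoc)
  moreover have "ktm_potential S L U \<rho> N x = (LINT y|lborel. of_real (?V y) * ?F y)"
    unfolding ktm_potential_def set_lebesgue_integral_def
    by (rule Bochner_Integration.integral_cong) (auto simp: indicator_def)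
  ultimately show "ktm_potential S L U \<rho> N x - of_real (potential U \<rho> x) = integral\<^sup>L lborel (E N)"
    unfolding E_def right_diff_distrib using Bochner_Integration.integral_diff[OF F R] by simp
qed

text \<open>For \<open>x\<close> in the cube and \<open>y\<close> in the ball the density error is
  only evaluated where adequacy controls it; the integral of the absolute kernel enters the
  constant.\<close>

lemma ktm_spectral:
  fixes U :: "real ^ 'n \<Rightarrow> real"
  assumes "0 < L" "set_integrable lborel (trunc_ball L) U" "adequate_padding TYPE('n) L S" "\<rho> \<in> densities L"
  shows "spectral_approx (cube L) (ktm_potential S L U \<rho>) (potential U \<rho>)"
  unfolding spectral_approx_def
proof
  fix m
  let ?V = "\<lambda>y. indicator (trunc_ball L) y * U y"
  have V: "integrable lborel ?V" using assms(2) by (simp add: set_integrable_def)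
  obtain C where C: "\<And>N x. N > 0 \<Longrightarrow> x \<in> cube ((2 * sqrt (real CARD('n)) + 1) * L) \<Longrightarrow>
      norm (padded_fourier S L \<rho> N x - of_real (\<rho> x)) \<le> C / real N ^ m"
    using assms(3,4) unfolding adequate_padding_def spectral_approx_def by metis
  have "norm (ktm_potential S L U \<rho> N x - of_real (potential U \<rho> x)) \<le> (C * (LINT y|lborel. \<bar>?V y\<bar>)) / real N ^ m"
    if N: "N > 0" and x: "x \<in> cube L" for N and x :: "real ^ 'n"
  proof -
    have "norm (ktm_potential S L U \<rho> N x - of_real (potential U \<rho> x)) \<le> (LINT y|lborel. C / real N ^ m * \<bar>?V y\<bar>)"
      unfolding ktm_error_integral(2)[OF assms(1,2,4) x]
    proof (rule Bochner_Integration.integral_norm_bound_integral[OF ktm_error_integral(1)[OF assms(1,2,4) x]])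
      show "integrable lborel (\<lambda>y. C / real N ^ m * \<bar>?V y\<bar>)" by (intro integrable_mult_right integrable_abs V)
      fix y :: "real ^ 'n"
      show "norm (of_real (?V y) * (padded_fourier S L \<rho> N (x - y) - of_real (\<rho> (x - y)))) \<le> C / real N ^ m * \<bar>?V y\<bar>"
      proof (cases "y \<in> trunc_ball L")
        case True
        then have "x - y \<in> cube ((2 * sqrt (real CARD('n)) + 1) * L)"
          using truncation_region[OF assms(1)] x by blast
        from mult_right_mono[OF C[OF N this], of "\<bar>?V y\<bar>"] show ?thesis
          by (simp only: norm_mult norm_of_real mult.commute abs_ge_zero)
      qed simp
    qed
    then show ?thesis by simp
  qed
  then show "\<exists>C. \<forall>N>0. \<forall>x\<in>cube L. norm (ktm_potential S L U \<rho> N x - of_real (potential U \<rho> x)) \<le> C / real N ^ m"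
    by blast
qed

text \<open>If \<open>S < sqrt d + 1\<close>, a periodic copy of a bump near a face of \<open>cube L\<close> lies within the truncation
  distance of a point on the opposite face, and a positive kernel sees it.\<close>

lemma ktm_spectral_imp_padding:
  fixes U :: "real ^ 'n \<Rightarrow> real"
  assumes "0 < L" "1 < S" "set_integrable lborel (trunc_ball L) U"
    and pos: "AE y in lborel. y \<in> trunc_ball L \<longrightarrow> 0 < U y"
    and spectral: "\<And>\<rho>. \<rho> \<in> densities L \<Longrightarrow> spectral_approx (cube L) (ktm_potential S L U \<rho>) (potential U \<rho>)"
  shows "sqrt (real CARD('n)) + 1 \<le> S"
proof (rule ccontr)
  assume S: "\<not> sqrt (real CARD('n)) + 1 \<le> S"
  define a where "a = S * L"
  have a: "L < a" "0 < a" using assms(1,2) by (auto simp: a_def)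
  define i :: 'n where "i = undefined"
  define e :: "real ^ 'n" where "e = axis i 1"
  have e: "e $ i = 1" "norm e = 1" by (simp_all add: e_def)
  have e_other: "e $ j = 0" if "j \<noteq> i" for j using that by (simp add: e_def axis_def)
  have e_int: "e = (\<chi> j. of_int ((axis i 1 :: int ^ 'n) $ j))" by (simp add: e_def axis_def vec_eq_iff)
  \<comment> \<open>The bound \<open>L\<close> lets the bump fit into the cube. The other bound
    leaves room for a ball of radius at most \<open>\<epsilon>\<close> about \<open>y0\<close>,
    whose norm is \<open>2 * a - 2 * L + \<epsilon>\<close>, inside the truncation ball.\<close>
  define \<epsilon> where "\<epsilon> = min L ((sqrt (real CARD('n)) + 1 - S) * L)"
  have eps: "0 < \<epsilon>" "\<epsilon> \<le> L" "\<epsilon> \<le> (sqrt (real CARD('n)) + 1 - S) * L"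
    using S assms(1) unfolding \<epsilon>_def by (simp, linarith+)
  define z where "z = (\<epsilon> - L) *\<^sub>R e"
  have "\<bar>z $ j\<bar> + \<epsilon> \<le> L" for j using eps e e_other by (cases "j = i") (auto simp: z_def)
  then obtain \<rho> where \<rho>: "\<rho> \<in> densities L" "\<And>x. 0 \<le> \<rho> x" "0 < \<rho> z"
    using bump_density[OF eps(1)] by metis
  define c where "c = \<rho> z / 2"
  have "isCont \<rho> z"
    using smooth_continuous_on[OF densities_smooth[OF \<rho>(1)], of UNIV] by (simp add: continuous_on_eq_continuous_at)
  then obtain \<delta>0 where \<delta>0: "0 < \<delta>0" "\<And>w. dist w z < \<delta>0 \<Longrightarrow> dist (\<rho> w) (\<rho> z) < c"
    using \<rho>(3) unfolding continuous_at_eps_delta c_def by (metis half_gt_zero)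
  define \<delta> where "\<delta> = min \<delta>0 \<epsilon>"
  have \<delta>: "0 < \<delta>" "\<delta> \<le> \<epsilon>" using \<delta>0 eps by (auto simp: \<delta>_def)
  have near: "c < \<rho> w" if "dist w z < \<delta>" for w
  proof -
    have "\<bar>\<rho> w - \<rho> z\<bar> < c" using \<delta>0(2)[of w] that by (simp add: \<delta>_def dist_real_def)
    moreover have "\<rho> z = 2 * c" by (simp add: c_def)
    ultimately show ?thesis by linarith
  qed
  define x where "x = L *\<^sub>R e"
  have x: "x \<in> cube L" using assms(1) by (auto simp: mem_cube x_def e_def axis_def)
  \<comment> \<open>Chosen so that \<open>x - y0\<close> is \<open>z + (2 * a) *\<^sub>R e\<close>,
    the centre of the periodic copy next to the face containing \<open>x\<close>.\<close>
  define y0 where "y0 = x - z - (2 * a) *\<^sub>R e"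
  define W where "W = ball y0 \<delta>"
  have W_sub: "W \<subseteq> trunc_ball L"
  proof
    fix y assume "y \<in> W"
    then have "norm (y - y0) < \<delta>" by (simp add: W_def dist_norm norm_minus_commute)
    moreover have "y0 = (2 * L - \<epsilon> - 2 * a) *\<^sub>R e" 
      by (simp add: y0_def x_def z_def flip: scaleR_left_diff_distrib)
    then have "norm y0 = 2 * a - 2 * L + \<epsilon>" using a eps by (simp add: e)
    ultimately have "norm y \<le> 2 * a - 2 * L + 2 * \<epsilon>"
      using norm_triangle_ineq[of "y - y0" y0] \<delta> by simp
    also have "\<dots> \<le> 2 * sqrt (real CARD('n)) * L" using eps(3) by (simp add: a_def algebra_simps)
    finally show "y \<in> trunc_ball L" by (simp add: trunc_ball_def)
  qed
  obtain C1 where C1: "\<And>N. N > 0 \<Longrightarrow> norm (ktm_potential S L U \<rho> N x - of_real (potential U \<rho> x)) \<le> C1 / real N"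
    using spectral[OF \<rho>(1)] x unfolding spectral_approx_def by (metis power_one_right)
  obtain C2 where C2: "0 \<le> C2" "\<And>N v. N > 0 \<Longrightarrow> v \<in> cube a \<Longrightarrow>
      norm (finite_fourier N a \<rho> v - of_real (\<rho> v)) \<le> C2 / real N"
    using finite_fourier_error[OF \<rho>(1) a(1) assms(1), of 1] by auto
  have Re_ge: "\<rho> v - C2 / real N \<le> Re (finite_fourier N a \<rho> v)" if "N > 0" "v \<in> cube a" for N v
    using C2(2)[OF that] abs_Re_le_cmod[of "finite_fourier N a \<rho> v - of_real (\<rho> v)"] by simp
  have cube_sub: "cube L \<subseteq> (cube a :: (real ^ 'n) set)" by (rule cube_mono) (use a in simp)
  \<comment> \<open>The interpolant is close to a periodic function that is nonnegative; outside the
    cube \<open>\<rho>\<close> is 0, so the error can only be positive up to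
    \<open>C2 / N\<close>.\<close>
  have lower: "- (C2 / real N) \<le> Re (finite_fourier N a \<rho> u) - \<rho> u" if N: "N > 0" for N u
  proof (cases "u \<in> cube L")
    case True
    then show ?thesis using Re_ge[OF N, of u] cube_sub by auto
  next
    case False
    obtain l :: "int ^ 'n" where l: "u - (2 * a) *\<^sub>R (\<chi> i. of_int (l $ i)) \<in> cube a"
      using cube_representative[OF a(2)] by blast
    have "finite_fourier N a \<rho> u = finite_fourier N a \<rho> (u - (2 * a) *\<^sub>R (\<chi> i. of_int (l $ i)))"
      using finite_fourier_periodic[of a N \<rho> "u - (2 * a) *\<^sub>R (\<chi> i. of_int (l $ i))" l] a by simp
    then show ?thesis
      using Re_ge[OF N l] \<rho>(2)[of "u - (2 * a) *\<^sub>R (\<chi> i. of_int (l $ i))"] densities_outside[OF \<rho>(1) False]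
      by simp
  qed
  \<comment> \<open>For \<open>y\<close> in \<open>W\<close> the point \<open>x - y\<close> lies in
    the copy of the bump: the density is 0 there while the interpolant is close to a value above
    \<open>c\<close>.\<close>
  have lower_W: "c - C2 / real N \<le> Re (finite_fourier N a \<rho> (x - y)) - \<rho> (x - y)" if N: "N > 0" and y: "y \<in> W" for N y
  proof -
    define w where "w = x - y - (2 * a) *\<^sub>R e"
    have xy: "x - y = w + (2 * a) *\<^sub>R e" by (simp add: w_def)
    have "w - z = y0 - y" by (simp add: w_def y0_def)
    then have "dist w z < \<delta>" using y by (simp add: W_def dist_norm)
    then have "c < \<rho> w" by (rule near)
    moreover have "0 < c" using \<rho>(3) by (simp add: c_def)
    ultimately have w: "w \<in> cube L" using densities_outside[OF \<rho>(1), of w] by force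
    have "finite_fourier N a \<rho> (x - y) = finite_fourier N a \<rho> w"
      unfolding xy e_int by (rule finite_fourier_periodic) (use a in simp)
    moreover have "\<rho> (x - y) = 0"
    proof (rule densities_outside_interior[OF \<rho>(1)])
      have "\<bar>w $ i\<bar> \<le> L" using w by (simp add: mem_cube)
      then show "L \<le> \<bar>(x - y) $ i\<bar>" using a by (simp add: xy e)
    qed
    ultimately show ?thesis using Re_ge[OF N, of w] w cube_sub \<open>c < \<rho> w\<close> by auto
  qed
  let ?V = "\<lambda>y. indicator (trunc_ball L) y * U y"
  have V: "integrable lborel ?V" using assms(3) by (simp add: set_integrable_def)
  have VW: "integrable lborel (\<lambda>y. ?V y * indicator W y)"
    using integrable_mult_indicator[OF _ V, of W] by (simp add: W_def mult_ac)
  have V_nonneg: "AE y in lborel. 0 \<le> ?V y"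
    using pos by eventually_elim (auto simp: indicator_def)
  define I where "I = (LINT y|lborel. ?V y * indicator W y)"
  have I_nonneg: "0 \<le> I"
    unfolding I_def by (rule integral_nonneg_AE) (use V_nonneg in \<open>eventually_elim, auto\<close>)
  have "I \<noteq> 0"
  proof
    assume "I = 0"
    moreover have "AE y in lborel. 0 \<le> ?V y * indicator W y" using V_nonneg by eventually_elim auto
    ultimately have "AE y in lborel. ?V y * indicator W y = 0"
      using integral_nonneg_eq_0_iff_AE[OF VW] by (simp add: I_def)
    with pos have "AE y in lborel. y \<notin> W"
      by eventually_elim (use W_sub in \<open>auto simp: indicator_def split: if_splits\<close>)
    then have "W \<in> null_sets lborel" by (subst AE_iff_null_sets) (auto simp: W_def)
    then have "measure lborel W = 0" by (simp add: null_sets_def measure_def)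
    with content_ball_pos[OF \<delta>(1), of y0] show False by (simp add: W_def)
  qed
  with I_nonneg have "0 < I" by simp
  define J where "J = (LINT y|lborel. ?V y)"
  \<comment> \<open>Integrating the two lower bounds against the nonnegative kernel makes the
    potential error at least \<open>c * I - C2 * J / N\<close>. Spectral accuracy caps it by
    \<open>C1 / N\<close>, which is impossible for large \<open>N\<close>.\<close>
  have bound: "c * I \<le> (C1 + C2 * J) / real N" if N: "N > 0" for N
  proof -
    let ?E = "\<lambda>y. of_real (?V y) * (padded_fourier S L \<rho> N (x - y) - of_real (\<rho> (x - y)))"
    note E = ktm_error_integral[OF assms(1,3) \<rho>(1) x, of S N]
    have "c * I - C2 / real N * J = (LINT y|lborel. c * (?V y * indicator W y) - C2 / real N * ?V y)"
      unfolding I_def J_def using V VW by (subst Bochner_Integration.integral_diff) auto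
    also have "\<dots> \<le> (LINT y|lborel. Re (?E y))"
    proof (rule integral_mono_AE)
      show "integrable lborel (\<lambda>y. c * (?V y * indicator W y) - C2 / real N * ?V y)"
        using V VW by (intro Bochner_Integration.integrable_diff integrable_mult_right)
      show "integrable lborel (\<lambda>y. Re (?E y))" by (rule integrable_Re[OF E(1)])
      show "AE y in lborel. c * (?V y * indicator W y) - C2 / real N * ?V y \<le> Re (?E y)"
        using V_nonneg
      proof eventually_elim
        case (elim y)
        have "c * indicator W y - C2 / real N \<le> Re (finite_fourier N a \<rho> (x - y)) - \<rho> (x - y)"
          using lower[OF N, of "x - y"] lower_W[OF N, of y] by (cases "y \<in> W") auto
        from mult_left_mono[OF this elim]
        have "?V y * (c * indicator W y - C2 / real N) \<le> Re (?E y)"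
          by (simp add: padded_fourier_eq[OF \<rho>(1)] a_def)
        then show ?case by (simp add: algebra_simps)
      qed
    qed
    also have "\<dots> = Re (integral\<^sup>L lborel ?E)" by (rule integral_Re[OF E(1)])
    also have "\<dots> \<le> norm (integral\<^sup>L lborel ?E)" by (rule complex_Re_le_cmod)
    also have "\<dots> \<le> C1 / real N" unfolding E(2)[symmetric] by (rule C1[OF N])
    finally show ?thesis by (simp add: add_divide_distrib)
  qed
  have cI: "0 < c * I" using \<rho>(3) \<open>0 < I\<close> by (simp add: c_def)
  obtain n :: nat where n: "(C1 + C2 * J) / (c * I) < real n" using reals_Archimedean2 by blast
  have "(C1 + C2 * J) / (c * I) < real (Suc n)" using n by simp
  then have "(C1 + C2 * J) / real (Suc n) < c * I"
    using cI by (simp only: pos_divide_less_eq of_nat_0_less_iff zero_less_Suc mult.commute)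
  with bound[of "Suc n"] show False by simp
qed

text \<open>Necessity is obtained by a detour: adequate padding makes the method accurate for the
  constant kernel 1, which is positive and integrable on the ball, and this accuracy forces the
  threshold.\<close>

lemma adequate_padding_iff:
  assumes "0 < L" "1 < S"
  shows "adequate_padding TYPE('n::finite) L S \<longleftrightarrow> sqrt (real CARD('n)) + 1 \<le> S"
proof
  assume ad: "adequate_padding TYPE('n) L S"
  have one: "set_integrable lborel (trunc_ball L) (\<lambda>_ :: real ^ 'n. 1 :: real)"
    unfolding set_integrable_def trunc_ball_def
    by (rule borel_integrable_compact) (auto intro: continuous_on_const)
  show "sqrt (real CARD('n)) + 1 \<le> S"
    by (rule ktm_spectral_imp_padding[OF assms one _ ktm_spectral[OF assms(1) one ad]]) auto
qed (rule adequate_padding_sufficient[OF assms])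

lemma ceiling_sqrt_plus_one:
  "\<lceil>sqrt 2 + 1\<rceil> = (3 :: int)" "\<lceil>sqrt 3 + 1\<rceil> = (3 :: int)"
proof -
  have "1 < sqrt 2" "sqrt 2 \<le> 2" "1 < sqrt 3" "sqrt 3 \<le> 2"
    by (auto intro!: real_le_lsqrt real_less_rsqrt)
  then show "\<lceil>sqrt 2 + 1\<rceil> = (3 :: int)" "\<lceil>sqrt 3 + 1\<rceil> = (3 :: int)"
    by (simp_all add: ceiling_eq_iff)
qed

theorem mainTheorem1:
  fixes L :: real
  assumes d: "CARD('n::finite) \<in> {1, 2, 3}"
    and L: "L > 0"
  shows
    "(\<forall>S>1. \<forall>\<rho> \<in> densities L :: (real ^ 'n \<Rightarrow> real) set.
        spectral_approx (cube ((2 * S - 1) * L)) (padded_fourier S L \<rho>) \<rho>)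
   \<and> \<comment> \<open>the region on which the kernel truncation method needs the density\<close>
     (\<forall>a. (\<forall>x \<in> cube L :: (real ^ 'n) set. \<forall>y \<in> trunc_ball L. x - y \<in> cube a)
         \<longleftrightarrow> (2 * sqrt (real CARD('n)) + 1) * L \<le> a)
   \<and> (\<forall>U :: real ^ 'n \<Rightarrow> real. set_integrable lborel (trunc_ball L) U \<longrightarrow>
        (\<forall>\<rho> \<in> densities L. \<forall>x \<in> cube L.
           potential U \<rho> x = (LINT y:trunc_ball L|lborel. U y * \<rho> (x - y))))
   \<and> (\<forall>S>1. \<forall>U :: real ^ 'n \<Rightarrow> real. set_integrable lborel (trunc_ball L) U \<longrightarrow>
        adequate_padding TYPE('n) L S \<longrightarrow>
        (\<forall>\<rho> \<in> densities L. spectral_approx (cube L) (ktm_potential S L U \<rho>) (potential U \<rho>)))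
   \<and> (\<forall>S>1. \<forall>U :: real ^ 'n \<Rightarrow> real. set_integrable lborel (trunc_ball L) U \<longrightarrow>
        (AE y in lborel. y \<in> trunc_ball L \<longrightarrow> 0 < U y) \<longrightarrow>
        (\<forall>\<rho> \<in> densities L. spectral_approx (cube L) (ktm_potential S L U \<rho>) (potential U \<rho>)) \<longrightarrow>
        adequate_padding TYPE('n) L S)
   \<and> \<comment> \<open>sufficiency and necessity\<close>
     (\<forall>S>1. (2 * sqrt (real CARD('n)) + 1 \<le> 2 * S - 1 \<longleftrightarrow> sqrt (real CARD('n)) + 1 \<le> S)
          \<and> (adequate_padding TYPE('n) L S \<longleftrightarrow> 2 * sqrt (real CARD('n)) + 1 \<le> 2 * S - 1))
   \<and> \<comment> \<open>the optimal factor\<close>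
     (sqrt (real CARD('n)) + 1 > 1 \<and> adequate_padding TYPE('n) L (sqrt (real CARD('n)) + 1)
      \<and> (\<forall>S>1. adequate_padding TYPE('n) L S \<longrightarrow> sqrt (real CARD('n)) + 1 \<le> S))
   \<and> \<comment> \<open>the practical choice\<close>
     adequate_padding TYPE('n) L (of_int \<lceil>sqrt (real CARD('n)) + 1\<rceil>)
   \<and> (CARD('n) = 1 \<longrightarrow> \<lceil>sqrt (real CARD('n)) + 1\<rceil> = 2)
   \<and> (CARD('n) = 2 \<or> CARD('n) = 3 \<longrightarrow> \<lceil>sqrt (real CARD('n)) + 1\<rceil> = 3)"
proof -
  have d1: "1 \<le> real CARD('n)" using d by auto
  have sqrt1: "1 \<le> sqrt (real CARD('n))" using d1 by simp
  let ?s = "sqrt (real CARD('n)) + 1"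
  have adequate: "adequate_padding TYPE('n) L S \<longleftrightarrow> ?s \<le> S" if "1 < S" for S
    by (rule adequate_padding_iff[OF L that])
  have arith: "2 * sqrt (real CARD('n)) + 1 \<le> 2 * S - 1 \<longleftrightarrow> ?s \<le> S" for S by auto
  have ceil: "?s \<le> of_int \<lceil>?s\<rceil>" by (rule le_of_int_ceiling)
  show ?thesis
  proof (intro conjI allI impI ballI)
    fix S :: real and \<rho> :: "real ^ 'n \<Rightarrow> real"
    assume "1 < S" "\<rho> \<in> densities L"
    then show "spectral_approx (cube ((2 * S - 1) * L)) (padded_fourier S L \<rho>) \<rho>"
      by (intro padded_fourier_spectral L)
  next
    fix a
    show "(\<forall>x \<in> cube L :: (real ^ 'n) set. \<forall>y \<in> trunc_ball L. x - y \<in> cube a)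
         \<longleftrightarrow> (2 * sqrt (real CARD('n)) + 1) * L \<le> a"
      by (rule truncation_region[OF L])
  next
    fix U \<rho> :: "real ^ 'n \<Rightarrow> real" and x :: "real ^ 'n"
    assume "set_integrable lborel (trunc_ball L) U" "\<rho> \<in> densities L" "x \<in> cube L"
    then show "potential U \<rho> x = (LINT y:trunc_ball L|lborel. U y * \<rho> (x - y))"
      by (rule potential_truncated[OF L])
  next
    fix S :: real and U \<rho> :: "real ^ 'n \<Rightarrow> real"
    assume "set_integrable lborel (trunc_ball L) U" "adequate_padding TYPE('n) L S" "\<rho> \<in> densities L"
    then show "spectral_approx (cube L) (ktm_potential S L U \<rho>) (potential U \<rho>)"
      by (rule ktm_spectral[OF L])
  next
    fix S :: real and U :: "real ^ 'n \<Rightarrow> real"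
    assume S: "1 < S" and "set_integrable lborel (trunc_ball L) U"
      "AE y in lborel. y \<in> trunc_ball L \<longrightarrow> 0 < U y"
      "\<forall>\<rho> \<in> densities L. spectral_approx (cube L) (ktm_potential S L U \<rho>) (potential U \<rho>)"
    \<comment> \<open>Accuracy for this one positive kernel already forces the threshold, and the
      threshold gives adequacy for all densities.\<close>
    then have "?s \<le> S" by (intro ktm_spectral_imp_padding[OF L S]) auto
    then show "adequate_padding TYPE('n) L S" using adequate[OF S] by blast
  next
    fix S :: real
    assume "1 < S"
    then show "adequate_padding TYPE('n) L S \<longleftrightarrow> 2 * sqrt (real CARD('n)) + 1 \<le> 2 * S - 1"
      unfolding arith by (rule adequate)
  next
    show "adequate_padding TYPE('n) L ?s" using adequate[of ?s] sqrt1 by simp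
    show "adequate_padding TYPE('n) L (of_int \<lceil>?s\<rceil>)"
      using adequate[of "of_int \<lceil>?s\<rceil>"] sqrt1 ceil by simp
  qed (use sqrt1 adequate ceiling_sqrt_plus_one in auto)
qed

end
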